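(* Assume (A1)–(A6) of the context, let $0<t<\frac{1}{2\rho}$, and let $\{x_{i,k}\}$ be the sequence generated by the distributed projected subgradient method $x_{i,k+1}=\mathrm{Proj}_{\mathcal X}(v_{i,k}-\alpha_k g_{i,k})$, $g_{i,k}\in\partial f_i(v_{i,k})$, for solving the problem $\min_{x\in\mathcal X}f(x)$. Then: (1) If $\sum_{k=0}^\infty\alpha_k^2<\infty$, there exists $\bar\varphi_t$ such that $\lim_{k\to\infty}\varphi_t(x_{i,k})=\lim_{k\to\infty}\varphi_t(\bar x_k)=\bar\varphi_t$. (2) There exists $b_k=\mathcal{O}\big(\frac{L^2\alpha_k^2}{(1-\lambda)^2}\big)$ such that $$\inf_{k}\|\nabla\varphi_t(\bar x_k)\|^2\le \frac{2}{1-2t\rho}\cdot\frac{\varphi_t(\bar x_0)-\inf\varphi_t(x)+\sum_{k=0}^{\infty}b_k+\sum_{k=0}^{\infty}\frac{L^2\alpha_k^2}{2t}}{\sum_{k=0}^{\infty}\alpha_k}.$$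
   Context: Problem: $\min_{x\in\mathcal X} f(x)=\frac1N\sum_{i=1}^N f_i(x)$, where $\mathcal X\subset\mathbb{R}^n$ is a closed convex set known to all agents and $f_i$ is the objective of agent $i\in\mathcal V=\{1,\dots,N\}$. $\|\cdot\|$ is the Euclidean norm, $\mathrm{Proj}_{\mathcal X}$ the orthogonal projection onto $\mathcal X$. Weak convexity: $f_i$ is $\rho$-weakly convex ($\rho>0$) if $f_i=h_i-\frac{\rho}{2}\|\cdot\|^2$ for some convex $h_i$; then $\partial f_i(x):=\partial h_i(x)-\rho x$, with $\partial h_i$ the convex subdifferential. Network: at each time $k$, $(\mathcal V,E_k)$ is a graph and $A(k)=[a_{i,j}(k)]$ is an $N\times N$ matrix of nonnegative weights, where $a_{i,j}(k)$ is the weight agent $i$ gives to the information received from agent $j$; $(j,i)\in E_k$ means that agent $j$ communicates directly to agent $i$ at time $k$, i.e. $a_{i,j}(k)>0$. $\mathcal N_i(k)=\{j: a_{i,j}(k)>0\}$. Algorithm: initial points $x_{i,0}\in\mathcal X$; $v_{i,k}=\sum_{j\in\mathcal N_i(k)}a_{i,j}(k)x_{j,k}$; $x_{i,k+1}=\mathrm{Proj}_{\mathcal X}(v_{i,k}-\alpha_k g_{i,k})$, where $g_{i,k}$ is any element of $\partial f_i(v_{i,k})$ and $\alpha_k>0$ is the stepsize. Average: $\bar x_k=\frac1N\sum_{i=1}^N x_{i,k}$. Assumptions: (A1) There is $\eta\in(0,1)$ such that for all $i,j\in\{1,\dots,N\}$: $a_{i,i}(k)\ge\eta$ for all $k\ge0$,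 and $a_{i,j}(k)>0$ implies $a_{i,j}(k)\ge\eta$. (A2) Each $A(k)$ is doubly stochastic. (A3) The graph $(\mathcal V,E_\infty)$ is strongly connected, where $E_\infty=\{(j,i):(j,i)\in E_k\text{ for infinitely many indices }k\}$. (A4) There is an integer $T_0\ge1$ such that for every $(j,i)\in E_\infty$, agent $j$ sends its information to the neighboring agent $i$ at least once every $T_0$ consecutive time slots, i.e. $(j,i)\in E_k\cup E_{k+1}\cup\dots\cup E_{k+T_0-1}$ for every $k\ge0$. (A5) $f$ is bounded below; every $f_i$ is $\rho$-weakly convex; and every element of $\partial f_i(x)$ has norm at most $L$ for all $x\in\mathcal X$ and all $i$. (A6) $\alpha_k>0$, $\sum_{k=0}^\infty\alpha_k=\infty$, $\lim_{k\to\infty}\alpha_k=0$, $\lim_{k\to\infty}\alpha_{k+1}/\alpha_k=1$. Constant $\lambda$: for $k\ge s$ let $\Phi(k,s)=A(k)A(k-1)\cdots A(s)$. Under (A1)–(A4) there exist constants $c>0$, $\lambda\in(0,1)$ with $\|\Phi(k,s)-\frac1N\mathbf 1\mathbf 1^\top\|_{\mathrm{op}}\le c\lambda^{k-s}$, where $\mathbf 1\in\mathbb R^N$ is the all-ones vector and $\|\cdot\|_{\mathrm{op}}$ the matrix operator norm; $\lambda$ denotes this constant. Moreau envelope: $\varphi(x)=f(x)+\mathbb I_{\mathcal X}(x)$, with $\mathbb I_{\mathcal X}=0$ on $\mathcal X$ and $+\infty$ elsewhere, and $\varphi_t(x)=\min_{y\in\mathbb{R}^n}\{\varphi(y)+\frac1{2t}\|y-x\|^2\}$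 for $0<t<1/\rho$; $\varphi_t$ is $C^1$ and $\|\nabla\varphi_t(x)\|=\frac1t\|\hat x-x\|$ with $\hat x$ the unique minimizer. $\mathcal O(\cdot)$ is as $k\to\infty$. *)

theory Defs
  imports "HOL-Analysis.Analysis" "HOL-Library.Landau_Symbols"
begin

section \<open>Weakly convex functions and their subdifferentials\<close>

definition weakly_convex :: "real \<Rightarrow> ('a::real_inner \<Rightarrow> real) \<Rightarrow> bool" where
  "weakly_convex \<rho> f \<longleftrightarrow>
     \<rho> > 0 \<and> (\<exists>h. convex_on UNIV h \<and> (\<forall>x. f x = h x - \<rho> / 2 * (norm x)\<^sup>2))"

definition convex_subdiff :: "('a::real_inner \<Rightarrow> real) \<Rightarrow> 'a \<Rightarrow> 'a set" where
  "convex_subdiff h x = {g. \<forall>y. h y \<ge> h x + g \<bullet> (y - x)}"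

text \<open>The function \<open>h\<close> with \<open>f = h - (\<rho> / 2) \<parallel>\<cdot>\<parallel>\<^sup>2\<close> is determined by \<open>f\<close>,
  so the subdifferential \<open>\<partial>f(x) = \<partial>h(x) - \<rho> x\<close> can be written without choosing \<open>h\<close>.\<close>

definition weak_subdiff :: "real \<Rightarrow> ('a::real_inner \<Rightarrow> real) \<Rightarrow> 'a \<Rightarrow> 'a set" where
  "weak_subdiff \<rho> f x =
     (\<lambda>s. s - \<rho> *\<^sub>R x) ` convex_subdiff (\<lambda>z. f z + \<rho> / 2 * (norm z)\<^sup>2) x"


section \<open>Moreau envelope\<close>

definition ext_indicator :: "'a set \<Rightarrow> 'a \<Rightarrow> ereal" where
  "ext_indicator X x = (if x \<in> X then 0 else \<infinity>)"

text \<open>The infimum is taken in the extended reals. It is finite whenever \<open>\<phi>\<close> is bounded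
  below and somewhere finite; only then is the conversion to \<open>real\<close> meaningful.\<close>

definition moreau_envelope :: "real \<Rightarrow> ('a::real_inner \<Rightarrow> ereal) \<Rightarrow> 'a \<Rightarrow> real" where
  "moreau_envelope t \<phi> x =
     real_of_ereal (INF y. \<phi> y + ereal (1 / (2 * t) * (norm (y - x))\<^sup>2))"

text \<open>The gradient is unspecified at points where \<open>f\<close> is not differentiable.\<close>

definition gradient :: "('a::real_inner \<Rightarrow> real) \<Rightarrow> 'a \<Rightarrow> 'a" where
  "gradient f x = (THE D. GDERIV f x :> D)"


section \<open>Time-varying communication networks\<close>

text \<open>Agents are the elements of a finite type \<open>'m\<close>, so that \<open>N = CARD('m)\<close>. The entry
  \<open>A k $ i $ j\<close> is the weight that agent \<open>i\<close> gives at time \<open>k\<close> to the information from agent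
  \<open>j\<close>; the corresponding edge is \<open>(j, i)\<close>.\<close>

definition comm_edges :: "(nat \<Rightarrow> real^'m^'m) \<Rightarrow> nat \<Rightarrow> ('m \<times> 'm) set" where
  "comm_edges A k = {(j, i). A k $ i $ j > 0}"

definition comm_edges_inf :: "(nat \<Rightarrow> real^'m^'m) \<Rightarrow> ('m \<times> 'm) set" where
  "comm_edges_inf A = {e. infinite {k. e \<in> comm_edges A k}}"

text \<open>The vertex set is the whole type.\<close>

definition strongly_connected_edges :: "('m \<times> 'm) set \<Rightarrow> bool" where
  "strongly_connected_edges E \<longleftrightarrow> (\<forall>u v. (u, v) \<in> E\<^sup>*)"

definition doubly_stochastic :: "real^'m^'m \<Rightarrow> bool" where
  "doubly_stochastic M \<longleftrightarrow>
     (\<forall>i j. M $ i $ j \<ge> 0) \<and>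
     (\<forall>i. (\<Sum>j\<in>UNIV. M $ i $ j) = 1) \<and>
     (\<forall>j. (\<Sum>i\<in>UNIV. M $ i $ j) = 1)"

text \<open>For \<open>k \<ge> s\<close>, \<open>transition A k s = A k ** A (k - 1) ** \<dots> ** A s\<close>; the value for
  \<open>k < s\<close> is irrelevant.\<close>

primrec transition :: "(nat \<Rightarrow> real^'m^'m) \<Rightarrow> nat \<Rightarrow> nat \<Rightarrow> real^'m^'m" where
  "transition A 0 s = A 0"
| "transition A (Suc k) s =
     (if Suc k \<le> s then A (Suc k) else A (Suc k) ** transition A k s)"

definition consensus_rate :: "(nat \<Rightarrow> real^'m^'m) \<Rightarrow> real \<Rightarrow> real \<Rightarrow> bool" where
  "consensus_rate A c lam \<longleftrightarrow>
     c > 0 \<and> 0 < lam \<and> lam < 1 \<and>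
     (\<forall>k s. s \<le> k \<longrightarrow>
        onorm (\<lambda>y. (transition A k s - (\<chi> i j. 1 / real CARD('m))) *v y) \<le> c * lam ^ (k - s))"


section \<open>The distributed projected subgradient method\<close>

definition agent_mean :: "('m::finite \<Rightarrow> 'a::real_vector) \<Rightarrow> 'a" where
  "agent_mean y = (1 / real CARD('m)) *\<^sub>R (\<Sum>i\<in>UNIV. y i)"

definition mixed_point ::
    "(nat \<Rightarrow> real^'m^'m) \<Rightarrow> ('m \<Rightarrow> nat \<Rightarrow> 'a::real_vector) \<Rightarrow> 'm \<Rightarrow> nat \<Rightarrow> 'a" where
  "mixed_point A x i k = (\<Sum>j\<in>{j. A k $ i $ j > 0}. (A k $ i $ j) *\<^sub>R x j k)"

definition dist_proj_subgrad ::
    "'a::euclidean_space set \<Rightarrow> real \<Rightarrow> ('m::finite \<Rightarrow> 'a \<Rightarrow> real) \<Rightarrow> (nat \<Rightarrow> real^'m^'m) \<Rightarrow>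
     (nat \<Rightarrow> real) \<Rightarrow> ('m \<Rightarrow> nat \<Rightarrow> 'a) \<Rightarrow> ('m \<Rightarrow> nat \<Rightarrow> 'a) \<Rightarrow> bool" where
  "dist_proj_subgrad X \<rho> f A \<alpha> g x \<longleftrightarrow>
     (\<forall>i. x i 0 \<in> X) \<and>
     (\<forall>i k. g i k \<in> weak_subdiff \<rho> (f i) (mixed_point A x i k)) \<and>
     (\<forall>i k. x i (Suc k) = closest_point X (mixed_point A x i k - \<alpha> k *\<^sub>R g i k))"

end

theory Submission
  imports Defs
begin

text \<open>
  The Moreau envelope \<open>\<phi>t\<close> at the mean \<open>xbar k\<close> of the agents serves as a Lyapunov function.
  Let \<open>p\<close> be the proximal point of \<open>xbar k\<close>. Taking \<open>p\<close> as a competitor in the minimization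
  that defines \<open>\<phi>t (xbar (k + 1))\<close>, and using that the projection is nonexpansive, that the
  weights are doubly stochastic, the subgradient inequality for weakly convex functions, and the
  quadratic growth of the proximal objective around \<open>p\<close>, one obtains
  (lemma \<open>moreau_envelope_descent\<close>) a decrease of \<open>(1 - t \<rho>) \<alpha> k \<parallel>\<nabla>\<phi>t (xbar k)\<parallel>\<^sup>2\<close> up to
  the errors \<open>L\<^sup>2 (\<alpha> k)\<^sup>2 / (2 t)\<close> and a consensus error that is quadratic in \<open>\<alpha> k\<close> and the
  disagreement \<open>D k\<close> of the agents, their largest pairwise distance. The gradient is
  \<open>(xbar k - p) / t\<close> (lemma \<open>gradient_moreau_envelope\<close>), because \<open>\<phi>t\<close> lies between two
  paraboloids that touch at the point.

  The disagreement is at most a multiple of \<open>\<alpha> k\<close>. By strong connectivity and the bounded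
  communication intervals, the product of the weight matrices over some fixed number of steps has
  all entries bounded below (lemma \<open>window_product_scrambling\<close>), so over that many steps the
  disagreement contracts by a constant factor, up to perturbations by the steps of length at most
  \<open>\<alpha> k * L\<close>; and \<open>\<alpha> (k + 1) / \<alpha> k\<close> tends to 1, so \<open>\<alpha>\<close> decays more slowly than the contraction
  (lemma \<open>perturbed_contraction_le_stepsize\<close>). Hence the consensus error is at most
  \<open>b k = C (\<alpha> k)\<^sup>2\<close>.

  If \<open>\<Sum>(\<alpha> k)\<^sup>2\<close> is finite, then \<open>\<phi>t (xbar k)\<close> is decreasing up to summable errors and bounded
  below, so it converges; the values \<open>\<phi>t (x i k)\<close> have the same limit since \<open>\<phi>t\<close> is uniformly
  continuous on \<open>X\<close>. Summing the descent inequality gives the estimate for every finite horizon.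
  In the extended reals the final quotient has an infinite denominator and is therefore 0, even if
  the numerator is infinite; that the infimum of the squared gradient norms vanishes follows from
  \<open>\<alpha> k \<longlonglongrightarrow> 0\<close>, which makes the errors negligible compared with \<open>\<alpha> k\<close>.

  When \<open>L = 0\<close>, membership of \<open>b\<close> in the \<open>O\<close>-class forces \<open>b\<close> to vanish eventually; then all
  gradients on \<open>X\<close> are 0 and \<open>b = 0\<close> is admissible.
\<close>

section \<open>Weakly convex functions\<close>

text \<open>Translate the strict epigraph of \<open>h\<close> by \<open>- (x, h x)\<close>: a hyperplane through the origin that
  has this convex set on one side is not vertical, since \<open>h\<close> is finite everywhere, and its slope
  is a subgradient.\<close>

lemma convex_subdiff_nonempty:
  fixes h :: "'a::euclidean_space \<Rightarrow> real"
  assumes "convex_on UNIV h"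
  shows "convex_subdiff h x \<noteq> {}"
proof -
  define S where "S = {p :: 'a \<times> real. h (fst p + x) - h x < snd p}"
  have "convex S"
  proof (rule convexI)
    fix p q :: "'a \<times> real" and u v :: real
    assume p: "p \<in> S" "q \<in> S" and uv: "0 \<le> u" "0 \<le> v" "u + v = 1"
    have "x = u *\<^sub>R x + v *\<^sub>R x"
      using uv by (metis scaleR_add_left scaleR_one)
    then have eq: "u *\<^sub>R fst p + v *\<^sub>R fst q + x = u *\<^sub>R (fst p + x) + v *\<^sub>R (fst q + x)"
      by (simp add: algebra_simps)
    have hx: "h x = u * h x + v * h x"
      using uv by (metis distrib_right mult_1)
    have "h (u *\<^sub>R fst p + v *\<^sub>R fst q + x) \<le> u * h (fst p + x) + v * h (fst q + x)"
      unfolding eq using assms uv by (simp add: convex_on_def)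
    then have "h (u *\<^sub>R fst p + v *\<^sub>R fst q + x) - h x
        \<le> u * (h (fst p + x) - h x) + v * (h (fst q + x) - h x)"
      using hx by (simp add: algebra_simps)
    also have "\<dots> < u * snd p + v * snd q"
    proof (cases "u = 0")
      case True
      then show ?thesis using uv p by (simp add: S_def)
    next
      case False
      then have "u * (h (fst p + x) - h x) < u * snd p"
        using uv p by (simp add: S_def)
      moreover have "v * (h (fst q + x) - h x) \<le> v * snd q"
        using uv p by (intro mult_left_mono) (auto simp: S_def)
      ultimately show ?thesis by linarith
    qed
    finally show "u *\<^sub>R p + v *\<^sub>R q \<in> S"
      by (simp add: S_def)
  qed
  moreover have "0 \<notin> S" by (simp add: S_def)
  ultimately obtain p where p: "p \<noteq> 0" and sep: "\<And>q. q \<in> S \<Longrightarrow> 0 \<le> inner p q"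
    using separating_hyperplane_set_0[of S] by auto
  obtain a b where ab: "p = (a, b)" by (cases p)
  have sep': "0 \<le> inner a w + b * r" if "h (w + x) - h x < r" for w r
    using sep[of "(w, r)"] that by (simp add: S_def ab)
  have "0 \<le> b" using sep'[of 0 1] by simp
  have "b \<noteq> 0"
  proof
    assume "b = 0"
    then have "0 \<le> inner a (- a)"
      using sep'[of "- a" "h (- a + x) - h x + 1"] by simp
    then have "a = 0"
      by (metis inner_eq_zero_iff inner_ge_zero inner_minus_right neg_0_le_iff_le order_antisym)
    then show False using p ab \<open>b = 0\<close> by (simp add: zero_prod_def)
  qed
  with \<open>0 \<le> b\<close> have b: "0 < b" by simp
  have "h x + (- (1 / b) *\<^sub>R a) \<bullet> (y - x) \<le> h y" for y
  proof (rule field_le_epsilon)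
    fix e :: real assume "0 < e"
    then have "0 \<le> inner a (y - x) + b * (h y - h x + e)"
      by (intro sep') simp
    then have "0 \<le> (inner a (y - x) + b * (h y - h x + e)) / b"
      using b by simp
    also have "\<dots> = inner a (y - x) / b + (h y - h x + e)"
      using b by (simp add: add_divide_distrib)
    finally show "h x + (- (1 / b) *\<^sub>R a) \<bullet> (y - x) \<le> h y + e"
      by simp
  qed
  then have "- (1 / b) *\<^sub>R a \<in> convex_subdiff h x"
    by (simp add: convex_subdiff_def)
  then show ?thesis by blast
qed

lemma weakly_convex_convex_on:
  assumes "weakly_convex \<rho> f"
  shows "convex_on UNIV (\<lambda>z. f z + \<rho> / 2 * (norm z)\<^sup>2)"
  using assms by (auto simp: weakly_convex_def)

lemma weak_subdiff_nonempty:
  fixes f :: "'a::euclidean_space \<Rightarrow> real"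
  assumes "weakly_convex \<rho> f"
  shows "weak_subdiff \<rho> f x \<noteq> {}"
  using convex_subdiff_nonempty[OF weakly_convex_convex_on[OF assms]]
  by (simp add: weak_subdiff_def)

lemma weak_subdiff_lower_bound:
  assumes "s \<in> weak_subdiff \<rho> f x"
  shows "f x + s \<bullet> (y - x) - \<rho> / 2 * (norm (y - x))\<^sup>2 \<le> f y"
proof -
  obtain s' where s': "s = s' - \<rho> *\<^sub>R x"
    and "f x + \<rho> / 2 * (norm x)\<^sup>2 + s' \<bullet> (y - x) \<le> f y + \<rho> / 2 * (norm y)\<^sup>2"
    using assms by (auto simp: weak_subdiff_def convex_subdiff_def)
  then show ?thesis
    unfolding s' power2_norm_eq_inner
    by (simp add: inner_diff_left inner_diff_right inner_commute algebra_simps)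
qed

lemma weakly_convex_agent_mean:
  fixes fi :: "'m::finite \<Rightarrow> 'a::real_inner \<Rightarrow> real"
  assumes "\<And>i. weakly_convex \<rho> (fi i)"
  shows "weakly_convex \<rho> (\<lambda>y. agent_mean (\<lambda>i. fi i y))"
proof -
  let ?h = "\<lambda>i z. fi i z + \<rho> / 2 * (norm z)\<^sup>2"
  have "convex_on UNIV (\<lambda>z. agent_mean (\<lambda>i. ?h i z))"
  proof (rule convex_onI)
    fix s :: real and y z :: 'a assume s: "0 < s" "s < 1"
    have "?h i ((1 - s) *\<^sub>R y + s *\<^sub>R z) \<le> (1 - s) * ?h i y + s * ?h i z" for i
      using weakly_convex_convex_on[OF assms[of i]] s unfolding convex_on_def by auto
    then have "(\<Sum>i\<in>UNIV. ?h i ((1 - s) *\<^sub>R y + s *\<^sub>R z))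
        \<le> (\<Sum>i\<in>UNIV. (1 - s) * ?h i y + s * ?h i z)"
      by (rule sum_mono)
    also have "\<dots> = (1 - s) * (\<Sum>i\<in>UNIV. ?h i y) + s * (\<Sum>i\<in>UNIV. ?h i z)"
      by (subst sum.distrib) (simp only: sum_distrib_left)
    finally have "(\<Sum>i\<in>UNIV. ?h i ((1 - s) *\<^sub>R y + s *\<^sub>R z)) / real CARD('m)
        \<le> ((1 - s) * (\<Sum>i\<in>UNIV. ?h i y) + s * (\<Sum>i\<in>UNIV. ?h i z)) / real CARD('m)"
      by (rule divide_right_mono) simp
    then show "agent_mean (\<lambda>i. ?h i ((1 - s) *\<^sub>R y + s *\<^sub>R z))
        \<le> (1 - s) * agent_mean (\<lambda>i. ?h i y) + s * agent_mean (\<lambda>i. ?h i z)"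
      by (simp add: agent_mean_def add_divide_distrib)
  qed simp
  moreover have "agent_mean (\<lambda>i. fi i z) = agent_mean (\<lambda>i. ?h i z) - \<rho> / 2 * (norm z)\<^sup>2" for z
    by (simp add: agent_mean_def sum.distrib add_divide_distrib)
  moreover have "\<rho> > 0" using assms by (auto simp: weakly_convex_def)
  ultimately show ?thesis unfolding weakly_convex_def by blast
qed

lemma weakly_convex_continuous_on:
  fixes f :: "'a::euclidean_space \<Rightarrow> real"
  assumes "weakly_convex \<rho> f"
  shows "continuous_on S f"
proof -
  have "continuous_on UNIV (\<lambda>z. f z + \<rho> / 2 * (norm z)\<^sup>2)"
    by (rule convex_on_continuous[OF open_UNIV weakly_convex_convex_on[OF assms]])
  then have "continuous_on UNIV (\<lambda>z. (f z + \<rho> / 2 * (norm z)\<^sup>2) - \<rho> / 2 * (norm z)\<^sup>2)"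
    by (rule continuous_on_diff) (intro continuous_intros)
  then have "continuous_on UNIV f" by simp
  then show ?thesis by (rule continuous_on_subset) simp
qed

section \<open>The Moreau envelope\<close>

text \<open>The proximal points of \<open>f\<close> plus the indicator of \<open>X\<close> are the minimizers over \<open>X\<close> of the
  function whose infimum is the Moreau envelope.\<close>

definition is_prox :: "real \<Rightarrow> ('a::real_inner \<Rightarrow> real) \<Rightarrow> 'a set \<Rightarrow> 'a \<Rightarrow> 'a \<Rightarrow> bool" where
  "is_prox t f X x p \<longleftrightarrow> p \<in> X \<and>
     (\<forall>y\<in>X. f p + 1 / (2 * t) * (norm (p - x))\<^sup>2 \<le> f y + 1 / (2 * t) * (norm (y - x))\<^sup>2)"

lemma is_prox_exists:
  fixes f :: "'a::euclidean_space \<Rightarrow> real"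
  assumes X: "closed X" "X \<noteq> {}" and f: "continuous_on X f" "bdd_below (range f)" and t: "0 < t"
  shows "\<exists>p. is_prox t f X x p"
proof -
  let ?F = "\<lambda>y. f y + 1 / (2 * t) * (norm (y - x))\<^sup>2"
  obtain a where a: "a \<in> X" using X by blast
  obtain B where B: "\<And>y. B \<le> f y" using f(2) by (auto simp: bdd_below_def)
  define R where "R = sqrt (2 * t * (?F a - B))"
  have nn: "0 \<le> ?F a - B" using B[of a] t by (simp add: add_increasing2)
  have outside: "?F a \<le> ?F y" if "R < norm (y - x)" for y
  proof -
    have "2 * t * (?F a - B) = R\<^sup>2"
      using nn t unfolding R_def by simp
    also have "\<dots> \<le> (norm (y - x))\<^sup>2"
      using that nn t by (intro power_mono) (auto simp: R_def)
    finally have "?F a - B \<le> 1 / (2 * t) * (norm (y - x))\<^sup>2"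
      using t by (simp add: field_simps)
    then show ?thesis using B[of y] by linarith
  qed
  define K where "K = X \<inter> cball x (max R (norm (a - x)))"
  have aK: "a \<in> K" using a by (simp add: K_def dist_norm norm_minus_commute)
  have "compact K" unfolding K_def using X(1) by (intro closed_Int_compact compact_cball)
  moreover have "continuous_on K ?F"
    by (intro continuous_intros continuous_on_subset[OF f(1)]) (auto simp: K_def)
  ultimately obtain p where p: "p \<in> K" "\<And>y. y \<in> K \<Longrightarrow> ?F p \<le> ?F y"
    using continuous_attains_inf[of K ?F] aK by blast
  have "?F p \<le> ?F y" if "y \<in> X" for y
  proof (cases "y \<in> K")
    case False
    then have "R < norm (y - x)" using that by (simp add: K_def dist_norm norm_minus_commute)
    then show ?thesis using outside p(2)[OF aK] by fastforce
  qed (use p in blast)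
  then show ?thesis using p(1) by (auto simp: is_prox_def K_def)
qed

lemma moreau_envelope_prox:
  assumes "is_prox t f X x p"
  shows "moreau_envelope t (\<lambda>y. ereal (f y) + ext_indicator X y) x
    = f p + 1 / (2 * t) * (norm (p - x))\<^sup>2"
proof -
  let ?G = "\<lambda>y. ereal (f y) + ext_indicator X y + ereal (1 / (2 * t) * (norm (y - x))\<^sup>2)"
  have "(INF y. ?G y) = ereal (f p + 1 / (2 * t) * (norm (p - x))\<^sup>2)"
  proof (rule INF_eqI)
    fix y show "ereal (f p + 1 / (2 * t) * (norm (p - x))\<^sup>2) \<le> ?G y"
      using assms by (cases "y \<in> X") (auto simp: ext_indicator_def is_prox_def)
  next
    fix B assume "\<And>y. y \<in> UNIV \<Longrightarrow> B \<le> ?G y"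
    from this[of p] show "B \<le> ereal (f p + 1 / (2 * t) * (norm (p - x))\<^sup>2)"
      using assms by (simp add: ext_indicator_def is_prox_def)
  qed
  then show ?thesis by (simp add: moreau_envelope_def)
qed

lemma norm_sq_segment:
  fixes a b :: "'a::real_inner"
  shows "(norm ((1 - s) *\<^sub>R a + s *\<^sub>R b))\<^sup>2
    = (1 - s) * (norm a)\<^sup>2 + s * (norm b)\<^sup>2 - s * (1 - s) * (norm (b - a))\<^sup>2"
  unfolding power2_norm_eq_inner
  by (simp add: inner_add_left inner_add_right inner_diff_left inner_diff_right
      inner_commute algebra_simps)

text \<open>The function minimized by a proximal point is \<open>(1 / t - \<rho>)\<close>-strongly convex, so it grows
  quadratically away from the minimizer.\<close>

lemma is_prox_quadratic_growth:
  fixes f :: "'a::real_inner \<Rightarrow> real"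
  assumes p: "is_prox t f X x p" and f: "weakly_convex \<rho> f" and "convex X" and y: "y \<in> X"
  shows "f p + 1 / (2 * t) * (norm (p - x))\<^sup>2 + (1 / t - \<rho>) / 2 * (norm (y - p))\<^sup>2
    \<le> f y + 1 / (2 * t) * (norm (y - x))\<^sup>2"
proof -
  let ?F = "\<lambda>y. f y + 1 / (2 * t) * (norm (y - x))\<^sup>2"
  let ?c = "(1 / t - \<rho>) / 2 * (norm (y - p))\<^sup>2"
  have pX: "p \<in> X" and pmin: "\<And>y. y \<in> X \<Longrightarrow> ?F p \<le> ?F y"
    using p by (auto simp: is_prox_def)
  have step: "(1 - s) * ?c \<le> ?F y - ?F p" if s: "0 < s" "s < 1" for s
  proof -
    let ?z = "(1 - s) *\<^sub>R p + s *\<^sub>R y"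
    have "?z \<in> X" using \<open>convex X\<close> pX y s by (intro convexD) auto
    have 1: "f ?z + \<rho> / 2 * (norm ?z)\<^sup>2
        \<le> (1 - s) * (f p + \<rho> / 2 * (norm p)\<^sup>2) + s * (f y + \<rho> / 2 * (norm y)\<^sup>2)"
      using weakly_convex_convex_on[OF f] s unfolding convex_on_def by auto
    have 2: "?z - x = (1 - s) *\<^sub>R (p - x) + s *\<^sub>R (y - x)"
      by (simp add: algebra_simps)
    have 3: "(norm (?z - x))\<^sup>2 = (1 - s) * (norm (p - x))\<^sup>2 + s * (norm (y - x))\<^sup>2
        - s * (1 - s) * (norm (y - p))\<^sup>2"
      unfolding 2 norm_sq_segment by simp
    define K where "K = 1 / (2 * t)"
    then have K: "1 / (2 * t) = K" by simp
    define r where "r = \<rho> / 2"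
    have K': "(1 / t - \<rho>) / 2 = K - r" by (simp add: K[symmetric] r_def field_simps)
    have "?F p \<le> ?F ?z" using pmin[OF \<open>?z \<in> X\<close>] .
    also have "\<dots> \<le> (1 - s) * ?F p + s * ?F y - s * (1 - s) * ?c"
      using 1 unfolding 3 norm_sq_segment[of s p y] K K' r_def[symmetric] by (simp add: algebra_simps)
    finally have "?F p \<le> (1 - s) * ?F p + s * ?F y - s * (1 - s) * ?c" .
    moreover have "s * ((1 - s) * c) \<le> s * (b - a)"
      if "a \<le> (1 - s) * a + s * b - s * (1 - s) * c" for a b c :: real
      using that by (simp add: algebra_simps)
    ultimately have "s * ((1 - s) * ?c) \<le> s * (?F y - ?F p)" by blast
    then show ?thesis using s by simp
  qed
  have "?c \<le> ?F y - ?F p"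
  proof (rule tendsto_le)
    show "((\<lambda>s. (1 - s) * ?c) \<longlongrightarrow> ?c) (at_right 0)"
      by (auto intro!: tendsto_eq_intros)
    show "\<forall>\<^sub>F s in at_right (0::real). (1 - s) * ?c \<le> ?F y - ?F p"
      using step by (intro eventually_at_rightI[of 0 1]) auto
  qed auto
  then show ?thesis by linarith
qed

lemma is_prox_le:
  assumes "is_prox t f X x p" "y \<in> X"
  shows "f p + 1 / (2 * t) * (norm (p - x))\<^sup>2 \<le> f y + 1 / (2 * t) * (norm (y - x))\<^sup>2"
  using assms by (simp add: is_prox_def)

lemma moreau_envelope_quadratic_upper:
  fixes X :: "'a::real_inner set"
  defines "\<Phi> f t \<equiv> moreau_envelope t (\<lambda>y. ereal (f y) + ext_indicator X y)"
  assumes p: "is_prox t f X x p" and q: "is_prox t f X y q"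
  shows "\<Phi> f t y \<le> \<Phi> f t x + (1 / t) * ((y - x) \<bullet> (x - p)) + 1 / (2 * t) * (norm (y - x))\<^sup>2"
proof -
  have "\<Phi> f t y \<le> f p + 1 / (2 * t) * (norm (p - y))\<^sup>2"
    unfolding \<Phi>_def moreau_envelope_prox[OF q] using is_prox_le[OF q] p by (simp add: is_prox_def)
  also have "(norm (p - y))\<^sup>2 = (norm (p - x))\<^sup>2 + 2 * ((y - x) \<bullet> (x - p)) + (norm (y - x))\<^sup>2"
    unfolding power2_norm_eq_inner
    by (simp add: inner_diff_left inner_diff_right inner_commute algebra_simps)
  also have "f p + 1 / (2 * t) * \<dots> = \<Phi> f t x + (1 / t) * ((y - x) \<bullet> (x - p)) + 1 / (2 * t) * (norm (y - x))\<^sup>2"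
    unfolding \<Phi>_def moreau_envelope_prox[OF p] by (simp add: algebra_simps add_divide_distrib)
  finally show ?thesis .
qed

lemma moreau_envelope_quadratic_lower:
  fixes X :: "'a::real_inner set"
  defines "\<Phi> f t \<equiv> moreau_envelope t (\<lambda>y. ereal (f y) + ext_indicator X y)"
  assumes p: "is_prox t f X x p" and q: "is_prox t f X y q"
    and f: "weakly_convex \<rho> f" and X: "convex X" and t: "0 < t" "t < 1 / \<rho>"
  shows "\<Phi> f t x + (1 / t) * ((y - x) \<bullet> (x - p)) - 1 / (2 * (1 / t - \<rho>) * t\<^sup>2) * (norm (y - x))\<^sup>2
    \<le> \<Phi> f t y"
proof -
  define d where "d = q - p"
  define h where "h = y - x"
  define \<sigma> where "\<sigma> = 1 / t - \<rho>"
  have "0 < \<rho>" using f by (simp add: weakly_convex_def)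
  then have \<sigma>: "0 < \<sigma>" using t by (simp add: \<sigma>_def field_simps)
  have "q \<in> X" using q by (simp add: is_prox_def)
  from is_prox_quadratic_growth[OF p f X this]
  have growth: "f p + 1 / (2 * t) * (norm (p - x))\<^sup>2 + \<sigma> / 2 * (norm d)\<^sup>2
      \<le> f q + 1 / (2 * t) * (norm (q - x))\<^sup>2"
    by (simp add: \<sigma>_def d_def)
  have "(norm (q - y))\<^sup>2
      = (norm (q - x))\<^sup>2 + (norm h)\<^sup>2 + 2 * (h \<bullet> (x - p)) - 2 * (d \<bullet> h)"
    unfolding power2_norm_eq_inner d_def h_def
    by (simp add: inner_diff_left inner_diff_right inner_commute algebra_simps)
  then have "1 / (2 * t) * (norm (q - y))\<^sup>2 = 1 / (2 * t) * (norm (q - x))\<^sup>2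
      + 1 / (2 * t) * (norm h)\<^sup>2 + (1 / t) * (h \<bullet> (x - p)) - (1 / t) * (d \<bullet> h)"
    by (simp only:) (simp add: algebra_simps add_divide_distrib diff_divide_distrib)
  moreover have "0 \<le> 1 / (2 * t) * (norm h)\<^sup>2" using t by simp
  \<comment> \<open>completing the square in \<open>d\<close>\<close>
  moreover have "(1 / t) * (d \<bullet> h) \<le> \<sigma> / 2 * (norm d)\<^sup>2 + 1 / (2 * \<sigma> * t\<^sup>2) * (norm h)\<^sup>2"
  proof -
    have "0 \<le> 1 / (2 * \<sigma>) * (norm (\<sigma> *\<^sub>R d - (1 / t) *\<^sub>R h))\<^sup>2"
      using \<sigma> by simp
    also have "(norm (\<sigma> *\<^sub>R d - (1 / t) *\<^sub>R h))\<^sup>2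
        = \<sigma>\<^sup>2 * (norm d)\<^sup>2 - 2 * (\<sigma> * (1 / t) * (d \<bullet> h)) + (1 / t)\<^sup>2 * (norm h)\<^sup>2"
      unfolding power2_norm_eq_inner
      by (simp add: inner_diff_left inner_diff_right inner_commute algebra_simps power2_eq_square)
    finally show ?thesis
      using \<sigma> t by (simp add: power2_eq_square field_simps)
  qed
  ultimately show ?thesis
    using growth unfolding \<Phi>_def moreau_envelope_prox[OF p] moreau_envelope_prox[OF q]
      h_def[symmetric] \<sigma>_def[symmetric] by linarith
qed

lemma gradient_moreau_envelope:
  fixes X :: "'a::real_inner set"
  defines "\<Phi> f t \<equiv> moreau_envelope t (\<lambda>y. ereal (f y) + ext_indicator X y)"
  assumes p: "\<And>x. is_prox t f X x (p x)"
    and f: "weakly_convex \<rho> f" and X: "convex X" and t: "0 < t" "t < 1 / \<rho>"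
  shows "gradient (\<Phi> f t) x = (1 / t) *\<^sub>R (x - p x)"
proof -
  let ?D = "(1 / t) *\<^sub>R (x - p x)"
  define C where "C = max (1 / (2 * t)) (1 / (2 * (1 / t - \<rho>) * t\<^sup>2))"
  have est: "\<bar>\<Phi> f t y - \<Phi> f t x - (y - x) \<bullet> ?D\<bar> \<le> C * (norm (y - x))\<^sup>2" for y
  proof -
    have "1 / (2 * t) * (norm (y - x))\<^sup>2 \<le> C * (norm (y - x))\<^sup>2"
      and "1 / (2 * (1 / t - \<rho>) * t\<^sup>2) * (norm (y - x))\<^sup>2 \<le> C * (norm (y - x))\<^sup>2"
      by (intro mult_right_mono; simp add: C_def)+
    then show ?thesis
      using moreau_envelope_quadratic_upper[OF p[of x] p[of y]]
        moreau_envelope_quadratic_lower[OF p[of x] p[of y] f X t]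
      by (simp add: \<Phi>_def norm_minus_commute inner_diff_left abs_le_iff)
  qed
  have "GDERIV (\<Phi> f t) x :> ?D"
    unfolding gderiv_def has_derivative_at_within
  proof (intro conjI)
    show "bounded_linear (\<lambda>h. h \<bullet> ?D)" by (rule bounded_linear_inner_left)
    have div: "inverse n * e \<le> C * n" if "0 < n" "e \<le> C * n\<^sup>2" for n e
      using that by (simp add: field_simps power2_eq_square)
    show "((\<lambda>y. (\<Phi> f t y - \<Phi> f t x - (y - x) \<bullet> ?D) /\<^sub>R norm (y - x)) \<longlongrightarrow> 0) (at x)"
    proof (rule Lim_null_comparison)
      show "\<forall>\<^sub>F y in at x. norm ((\<Phi> f t y - \<Phi> f t x - (y - x) \<bullet> ?D) /\<^sub>R norm (y - x))
          \<le> C * norm (y - x)"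
      proof (rule eventually_at_filter[THEN iffD2], rule always_eventually, intro allI impI)
        fix y assume "y \<noteq> x"
        then show "norm ((\<Phi> f t y - \<Phi> f t x - (y - x) \<bullet> ?D) /\<^sub>R norm (y - x)) \<le> C * norm (y - x)"
          using div[of "norm (y - x)", OF _ est[of y]] unfolding norm_scaleR by simp
      qed
      have "((\<lambda>y. C * norm (y - x)) \<longlongrightarrow> C * norm (x - x)) (at x)"
        by (intro tendsto_intros)
      then show "((\<lambda>y. C * norm (y - x)) \<longlongrightarrow> 0) (at x)" by simp
    qed
  qed
  moreover have "D = ?D" if "GDERIV (\<Phi> f t) x :> D" for D
  proof -
    have "(\<lambda>h. h \<bullet> D) = (\<lambda>h. h \<bullet> ?D)"
      using that \<open>GDERIV (\<Phi> f t) x :> ?D\<close> unfolding gderiv_def by (rule has_derivative_unique)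
    then show ?thesis by (metis vector_eq_ldot inner_commute)
  qed
  ultimately show ?thesis unfolding gradient_def by (rule the_equality)
qed

section \<open>Consensus over time-varying networks\<close>

text \<open>The product \<open>A (k + n - 1) \<cdots> A k\<close> of the \<open>n\<close> weight matrices from time \<open>k\<close> on; unlike
  \<^const>\<open>transition\<close> it is indexed by the number of factors and includes the empty product.\<close>

primrec window_product :: "(nat \<Rightarrow> real^'m^'m) \<Rightarrow> nat \<Rightarrow> nat \<Rightarrow> real^'m^'m::finite" where
  "window_product A k 0 = mat 1"
| "window_product A k (Suc n) = A (k + n) ** window_product A k n"

lemma window_product_Suc_nth:
  "window_product A k (Suc n) $ i $ j = (\<Sum>l\<in>UNIV. A (k + n) $ i $ l * window_product A k n $ l $ j)"
  by (simp add: matrix_matrix_mult_def)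

lemma doubly_stochasticD:
  assumes "doubly_stochastic M"
  shows "0 \<le> M $ i $ j" "(\<Sum>j\<in>UNIV. M $ i $ j) = 1" "(\<Sum>i\<in>UNIV. M $ i $ j) = 1"
  using assms by (auto simp: doubly_stochastic_def)

lemma window_product_nonneg:
  assumes "\<And>k. doubly_stochastic (A k)"
  shows "0 \<le> window_product A k n $ i $ j"
proof (induction n arbitrary: i)
  case (Suc n)
  then show ?case unfolding window_product_Suc_nth
    by (intro sum_nonneg mult_nonneg_nonneg doubly_stochasticD(1)[OF assms])
qed (simp add: mat_def)

lemma window_product_row_sum:
  assumes "\<And>k. doubly_stochastic (A k)"
  shows "(\<Sum>j\<in>UNIV. window_product A k n $ i $ j) = 1"
proof (induction n arbitrary: i)
  case (Suc n)
  have "(\<Sum>j\<in>UNIV. window_product A k (Suc n) $ i $ j)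
      = (\<Sum>l\<in>UNIV. A (k + n) $ i $ l * (\<Sum>j\<in>UNIV. window_product A k n $ l $ j))"
    unfolding window_product_Suc_nth sum_distrib_left by (rule sum.swap)
  then show ?case using Suc doubly_stochasticD(2)[OF assms] by simp
qed (simp add: mat_def)

lemma window_product_step:
  assumes "\<And>k. doubly_stochastic (A k)" "c \<le> A (k + n) $ v $ w" "d \<le> window_product A k n $ w $ u"
    "0 \<le> c" "0 \<le> d"
  shows "c * d \<le> window_product A k (Suc n) $ v $ u"
proof -
  have "c * d \<le> A (k + n) $ v $ w * window_product A k n $ w $ u"
    using assms by (intro mult_mono) auto
  also have "\<dots> \<le> window_product A k (Suc n) $ v $ u"
    unfolding window_product_Suc_nth
    by (rule member_le_sum) (auto intro!: mult_nonneg_nonneg doubly_stochasticD window_product_nonneg assms)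
  finally show ?thesis .
qed

text \<open>Along an edge used at some time in a window of length \<open>T0\<close>, the lower bound \<open>\<eta>\<close> on
  self-weights lets the information wait at one end until the edge is used, and then at the
  other end until the window closes.\<close>

lemma window_product_edge:
  assumes ds: "\<And>k. doubly_stochastic (A k)" and \<eta>: "0 < \<eta>"
    and self: "\<And>k i. \<eta> \<le> A k $ i $ i"
    and pos: "\<And>k i j. 0 < A k $ i $ j \<Longrightarrow> \<eta> \<le> A k $ i $ j"
    and edge: "(w, v) \<in> (\<Union>m\<in>{k + n..<k + n + T0}. comm_edges A m)"
    and w: "\<eta> ^ n \<le> window_product A k n $ w $ u"
  shows "\<eta> ^ (n + T0) \<le> window_product A k (n + T0) $ v $ u"
proof -
  obtain m where m: "k + n \<le> m" "m < k + n + T0" and mw: "0 < A m $ v $ w"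
    using edge by (auto simp: comm_edges_def)
  define r where "r = m - (k + n)"
  have r: "m = k + (n + r)" "r < T0" using m by (auto simp: r_def)
  have stay: "\<eta> ^ (n1 + l) \<le> window_product A k (n1 + l) $ i $ u"
    if "\<eta> ^ n1 \<le> window_product A k n1 $ i $ u" for n1 l i
  proof (induction l)
    case (Suc l)
    have "\<eta> * \<eta> ^ (n1 + l) \<le> window_product A k (Suc (n1 + l)) $ i $ u"
      using \<eta> by (intro window_product_step[OF ds self Suc]) auto
    then show ?case by simp
  qed (use that in simp)
  have "\<eta> * \<eta> ^ (n + r) \<le> window_product A k (Suc (n + r)) $ v $ u"
    using \<eta> mw by (intro window_product_step[OF ds _ stay[OF w]] pos) (auto simp: r)
  then have "\<eta> ^ (Suc (n + r)) \<le> window_product A k (Suc (n + r)) $ v $ u" by simp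
  from stay[OF this, of "T0 - Suc r"] show ?thesis using r by simp
qed

lemma window_product_scrambling:
  fixes A :: "nat \<Rightarrow> real^'m^'m::finite"
  assumes ds: "\<And>k. doubly_stochastic (A k)" and \<eta>: "0 < \<eta>"
    and self: "\<And>k i. \<eta> \<le> A k $ i $ i"
    and pos: "\<And>k i j. 0 < A k $ i $ j \<Longrightarrow> \<eta> \<le> A k $ i $ j"
    and con: "strongly_connected_edges (comm_edges_inf A)"
    and T0: "\<And>e k. e \<in> comm_edges_inf A \<Longrightarrow> e \<in> (\<Union>m\<in>{k..<k + T0}. comm_edges A m)"
  shows "\<exists>n>0. \<forall>k i j. \<eta> ^ n \<le> window_product A k n $ i $ j"
proof -
  let ?E = "comm_edges_inf A"
  have loop: "(i, i) \<in> ?E" for i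
  proof -
    have "{k. (i, i) \<in> comm_edges A k} = UNIV"
      using less_le_trans[OF \<eta> self] by (auto simp: comm_edges_def)
    then show ?thesis by (simp add: comm_edges_inf_def)
  qed
  have reach: "\<eta> ^ (n * T0) \<le> window_product A k (n * T0) $ v $ u" if "(u, v) \<in> ?E ^^ n" for n k u v
    using that
  proof (induction n arbitrary: v)
    case 0
    then show ?case by (simp add: mat_def)
  next
    case (Suc n)
    then obtain w where w: "(u, w) \<in> ?E ^^ n" and wv: "(w, v) \<in> ?E" by auto
    have "\<eta> ^ (n * T0 + T0) \<le> window_product A k (n * T0 + T0) $ v $ u"
      by (rule window_product_edge[OF ds \<eta> self pos T0[OF wv] Suc.IH[OF w]])
    then show ?case by (simp add: add.commute)
  qed
  have mono: "(u, v) \<in> ?E ^^ (n + l)" if "(u, v) \<in> ?E ^^ n" for u v n l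
  proof (induction l)
    case (Suc l)
    then show ?case using loop[of v] by auto
  qed (use that in simp)
  have "\<exists>n. (fst p, snd p) \<in> ?E ^^ n" for p :: "'m \<times> 'm"
    using con unfolding strongly_connected_edges_def by (meson rtrancl_imp_relpow)
  then obtain len where len: "\<And>p. (fst p, snd p) \<in> ?E ^^ len p" by metis
  define n where "n = Suc (Max (range len))"
  have "(u, v) \<in> ?E ^^ n" for u v
  proof -
    have "len (u, v) \<le> Max (range len)" by simp
    then have "len (u, v) \<le> n" unfolding n_def by (rule le_SucI)
    then show ?thesis using mono[OF len[of "(u, v)", simplified], of "n - len (u, v)"] by simp
  qed
  then have "\<forall>k i j. \<eta> ^ (n * T0) \<le> window_product A k (n * T0) $ i $ j" using reach by blast
  moreover have "0 < n * T0" using T0[OF loop, of undefined 0] by (cases T0) (auto simp: n_def)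
  ultimately show ?thesis by blast
qed

text \<open>The disagreement of a family of points is the diameter of the set of its values.\<close>

definition disagreement :: "('m::finite \<Rightarrow> 'a::real_normed_vector) \<Rightarrow> real" where
  "disagreement y = Max (range (\<lambda>(i, j). norm (y i - y j)))"

lemma norm_diff_le_disagreement: "norm (y i - y j) \<le> disagreement y"
  using Max_ge[OF _ rangeI[of "\<lambda>(i, j). norm (y i - y j)" "(i, j)"]]
  by (simp add: disagreement_def)

lemma disagreement_le:
  assumes "\<And>i j. norm (y i - y j) \<le> c"
  shows "disagreement y \<le> c"
  using assms unfolding disagreement_def by (subst Max_le_iff) auto

lemma disagreement_nonneg: "0 \<le> disagreement y"
  using norm_diff_le_disagreement[of y undefined undefined] by simp

lemma norm_convex_combination_diff_le:
  fixes y :: "'m::finite \<Rightarrow> 'a::real_normed_vector"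
  assumes a: "\<And>j. 0 \<le> a j" "(\<Sum>j\<in>UNIV. a j) = 1" and c: "\<And>j. norm (y j - z) \<le> c"
  shows "norm ((\<Sum>j\<in>UNIV. a j *\<^sub>R y j) - z) \<le> c"
proof -
  have "(\<Sum>j\<in>UNIV. a j *\<^sub>R y j) - z = (\<Sum>j\<in>UNIV. a j *\<^sub>R (y j - z))"
    using a by (simp add: scaleR_diff_right sum_subtractf flip: scaleR_left.sum)
  also have "norm \<dots> \<le> (\<Sum>j\<in>UNIV. a j * c)"
    using a c by (intro sum_norm_le) (auto intro: mult_left_mono)
  also have "\<dots> = c" using a by (simp flip: sum_distrib_right)
  finally show ?thesis .
qed

text \<open>Write the difference of two averages as a double sum over pairs \<open>(l, m)\<close>: the diagonal
  pairs contribute nothing, and they carry a positive part of the total weight.\<close>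

lemma disagreement_contraction:
  fixes y :: "'m::finite \<Rightarrow> 'a::real_normed_vector" and P :: "real^'m^'m"
  assumes \<delta>: "0 \<le> \<delta>" "\<And>i j. \<delta> \<le> P $ i $ j" and row: "\<And>i. (\<Sum>j\<in>UNIV. P $ i $ j) = 1"
  shows "disagreement (\<lambda>i. \<Sum>j\<in>UNIV. (P $ i $ j) *\<^sub>R y j) \<le> (1 - \<delta>\<^sup>2) * disagreement y"
proof (rule disagreement_le)
  fix i j
  let ?D = "disagreement y"
  let ?w = "\<lambda>l m. P $ i $ l * P $ j $ m"
  have P0: "0 \<le> P $ a $ b" for a b using \<delta> order_trans by blast
  have "(\<Sum>l\<in>UNIV. (P $ i $ l) *\<^sub>R y l) = (\<Sum>l\<in>UNIV. \<Sum>m\<in>UNIV. ?w l m *\<^sub>R y l)"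
    using row[of j] by (simp flip: scaleR_left.sum sum_distrib_left)
  moreover have "(\<Sum>m\<in>UNIV. (P $ j $ m) *\<^sub>R y m) = (\<Sum>l\<in>UNIV. \<Sum>m\<in>UNIV. ?w l m *\<^sub>R y m)"
    using row[of i] by (subst sum.swap) (simp flip: scaleR_left.sum sum_distrib_right)
  ultimately have "(\<Sum>l\<in>UNIV. (P $ i $ l) *\<^sub>R y l) - (\<Sum>m\<in>UNIV. (P $ j $ m) *\<^sub>R y m)
      = (\<Sum>l\<in>UNIV. \<Sum>m\<in>UNIV. ?w l m *\<^sub>R (y l - y m))"
    by (simp add: sum_subtractf scaleR_diff_right)
  also have "norm \<dots> \<le> (\<Sum>l\<in>UNIV. \<Sum>m\<in>UNIV. (?w l m - (if l = m then ?w l m else 0)) * ?D)"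
  proof (intro sum_norm_le)
    fix l m
    show "norm (?w l m *\<^sub>R (y l - y m)) \<le> (?w l m - (if l = m then ?w l m else 0)) * ?D"
      using P0 norm_diff_le_disagreement[of y l m] by (auto simp: abs_mult intro!: mult_left_mono)
  qed
  also have "\<dots> = ((\<Sum>l\<in>UNIV. \<Sum>m\<in>UNIV. ?w l m) - (\<Sum>l\<in>UNIV. ?w l l)) * ?D"
    by (simp add: sum_subtractf flip: sum_distrib_right)
  also have "(\<Sum>l\<in>UNIV. \<Sum>m\<in>UNIV. ?w l m) = 1"
    using row by (simp flip: sum_distrib_left)
  also have "(1 - (\<Sum>l\<in>UNIV. ?w l l)) * ?D \<le> (1 - \<delta>\<^sup>2) * ?D"
  proof (intro mult_right_mono disagreement_nonneg diff_left_mono)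
    have "\<delta>\<^sup>2 \<le> ?w i i"
      using \<delta> P0 unfolding power2_eq_square by (intro mult_mono) auto
    also have "\<dots> \<le> (\<Sum>l\<in>UNIV. ?w l l)"
      by (rule member_le_sum[of i]) (use P0 in auto)
    finally show "\<delta>\<^sup>2 \<le> (\<Sum>l\<in>UNIV. ?w l l)" .
  qed
  finally show "norm ((\<Sum>l\<in>UNIV. (P $ i $ l) *\<^sub>R y l) - (\<Sum>m\<in>UNIV. (P $ j $ m) *\<^sub>R y m))
      \<le> (1 - \<delta>\<^sup>2) * ?D" .
qed

lemma perturbed_averaging_close:
  fixes y :: "'m::finite \<Rightarrow> nat \<Rightarrow> 'a::real_normed_vector"
  assumes ds: "\<And>k. doubly_stochastic (A k)"
    and y: "\<And>i k. norm (y i (Suc k) - (\<Sum>j\<in>UNIV. (A k $ i $ j) *\<^sub>R y j k)) \<le> \<epsilon> k"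
  shows "norm (y i (k + n) - (\<Sum>j\<in>UNIV. (window_product A k n $ i $ j) *\<^sub>R y j k)) \<le> (\<Sum>l<n. \<epsilon> (k + l))"
proof (induction n arbitrary: i)
  case 0
  have "(\<Sum>j\<in>UNIV. (window_product A k 0 $ i $ j) *\<^sub>R y j k)
      = (\<Sum>j\<in>UNIV. if i = j then y j k else 0)"
    by (intro sum.cong) (auto simp: mat_def)
  then show ?case by simp
next
  case (Suc n)
  let ?z = "\<lambda>l. \<Sum>j\<in>UNIV. (window_product A k n $ l $ j) *\<^sub>R y j k"
  have "(\<Sum>j\<in>UNIV. (window_product A k (Suc n) $ i $ j) *\<^sub>R y j k) = (\<Sum>l\<in>UNIV. (A (k + n) $ i $ l) *\<^sub>R ?z l)"
    unfolding window_product_Suc_nth scaleR_left.sum scaleR_right.sum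
    by (subst sum.swap) simp
  then have "y i (k + Suc n) - (\<Sum>j\<in>UNIV. (window_product A k (Suc n) $ i $ j) *\<^sub>R y j k)
      = (y i (Suc (k + n)) - (\<Sum>l\<in>UNIV. (A (k + n) $ i $ l) *\<^sub>R y l (k + n)))
        + ((\<Sum>l\<in>UNIV. (A (k + n) $ i $ l) *\<^sub>R (y l (k + n) - ?z l)) - 0)"
    by (simp add: scaleR_diff_right sum_subtractf)
  also have "norm \<dots> \<le> \<epsilon> (k + n) + (\<Sum>l<n. \<epsilon> (k + l))"
    using Suc by (intro norm_triangle_mono y norm_convex_combination_diff_le doubly_stochasticD ds) auto
  finally show ?case by (simp add: add.commute)
qed

lemma perturbed_averaging_disagreement:
  fixes y :: "'m::finite \<Rightarrow> nat \<Rightarrow> 'a::real_normed_vector"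
  assumes ds: "\<And>k. doubly_stochastic (A k)"
    and y: "\<And>i k. norm (y i (Suc k) - (\<Sum>j\<in>UNIV. (A k $ i $ j) *\<^sub>R y j k)) \<le> \<epsilon> k"
    and \<delta>: "0 \<le> \<delta>" "\<And>i j. \<delta> \<le> window_product A k n $ i $ j"
  shows "disagreement (\<lambda>i. y i (k + n)) \<le> (1 - \<delta>\<^sup>2) * disagreement (\<lambda>i. y i k) + 2 * (\<Sum>l<n. \<epsilon> (k + l))"
proof (rule disagreement_le)
  fix i j
  let ?z = "\<lambda>l. \<Sum>j\<in>UNIV. (window_product A k n $ l $ j) *\<^sub>R y j k"
  have 1: "norm (?z i - ?z j) \<le> (1 - \<delta>\<^sup>2) * disagreement (\<lambda>i. y i k)"
    using disagreement_contraction[OF \<delta> window_product_row_sum[OF ds], of "\<lambda>i. y i k"]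
      norm_diff_le_disagreement[of ?z i j] by linarith
  have 2: "norm (y l (k + n) - ?z l) \<le> (\<Sum>l<n. \<epsilon> (k + l))" for l
    by (rule perturbed_averaging_close[where y = y, OF ds y])
  have "norm (a - b) \<le> norm (a - a') + norm (a' - b') + norm (b - b')" for a b a' b' :: 'a
    using norm_triangle_ineq4[of "(a - a') + (a' - b')" "b - b'"]
      norm_triangle_ineq[of "a - a'" "a' - b'"] by simp
  from this[of "y i (k + n)" "y j (k + n)" "?z i" "?z j"]
  show "norm (y i (k + n) - y j (k + n))
      \<le> (1 - \<delta>\<^sup>2) * disagreement (\<lambda>i. y i k) + 2 * (\<Sum>l<n. \<epsilon> (k + l))"
    using 1 2[of i] 2[of j] by linarith
qed

lemma contracting_sequence_bounded:
  fixes r :: "nat \<Rightarrow> real"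
  assumes q: "q < 1" and r0: "\<And>k. 0 \<le> r k" and q0: "0 \<le> q"
    and rec: "\<And>k. K \<le> k \<Longrightarrow> r (k + B) \<le> q * r k + C" and C: "0 \<le> C" and B: "0 < B"
  shows "\<exists>M. \<forall>k. r k \<le> M"
proof -
  define M where "M = Max (r ` {..K + B}) + C / (1 - q)"
  have MC: "C \<le> (1 - q) * M"
  proof -
    have "0 \<le> Max (r ` {..K + B})"
      using r0[of 0] by (intro order_trans[OF _ Max_ge]) auto
    then have "C / (1 - q) \<le> M" by (simp add: M_def)
    then show ?thesis using q by (simp add: field_simps)
  qed
  have "r k \<le> M" for k
  proof (induction k rule: less_induct)
    case (less k)
    show ?case
    proof (cases "k \<le> K + B")
      case True
      then have "r k \<le> Max (r ` {..K + B})" by (intro Max_ge) auto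
      then show ?thesis using C q unfolding M_def by (simp add: add_increasing2)
    next
      case False
      then have "r k \<le> q * r (k - B) + C" using rec[of "k - B"] by simp
      also have "\<dots> \<le> q * M + C"
        using less[of "k - B"] False B q0 by (intro add_right_mono mult_left_mono) auto
      also have "\<dots> \<le> M" using MC by (simp add: algebra_simps)
      finally show ?thesis .
    qed
  qed
  then show ?thesis by blast
qed

lemma ratio_shift_tendsto_1:
  fixes \<alpha> :: "nat \<Rightarrow> real"
  assumes "\<And>k. 0 < \<alpha> k" "(\<lambda>k. \<alpha> (Suc k) / \<alpha> k) \<longlonglongrightarrow> 1"
  shows "(\<lambda>k. \<alpha> (k + n) / \<alpha> k) \<longlonglongrightarrow> 1"
proof (induction n)
  case 0
  have "\<alpha> k \<noteq> 0" for k using assms(1)[of k] by simp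
  then show ?case by simp
next
  case (Suc n)
  have nz: "\<alpha> k \<noteq> 0" for k using assms(1)[of k] by simp
  have "(\<lambda>k. \<alpha> (Suc (k + n)) / \<alpha> (k + n) * (\<alpha> (k + n) / \<alpha> k)) \<longlonglongrightarrow> 1 * 1"
    by (intro tendsto_mult Suc LIMSEQ_ignore_initial_segment[OF assms(2)])
  then show ?case using nz by simp
qed

text \<open>A contraction over \<open>B\<close> steps perturbed by terms of size \<open>\<alpha>\<close> stays below a multiple of
  \<open>\<alpha>\<close>, because a sequence with ratios tending to 1 decays slower than any geometric one.\<close>

lemma perturbed_contraction_le_stepsize:
  fixes D \<alpha> :: "nat \<Rightarrow> real"
  assumes \<alpha>: "\<And>k. 0 < \<alpha> k" "(\<lambda>k. \<alpha> (Suc k) / \<alpha> k) \<longlonglongrightarrow> 1"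
    and D: "\<And>k. 0 \<le> D k" and rec: "\<And>k. D (k + B) \<le> q * D k + C * (\<Sum>l<B. \<alpha> (k + l))"
    and q: "0 \<le> q" "q < 1" and C: "0 \<le> C" and B: "0 < B"
  shows "\<exists>M. \<forall>k. D k \<le> M * \<alpha> k"
proof -
  define r where "r k = D k / \<alpha> k" for k
  define q' where "q' = (1 + q) / 2"
  have q': "0 \<le> q'" "q' < 1" "q < q'" using q by (auto simp: q'_def)
  have nz: "\<alpha> k \<noteq> 0" for k using \<alpha>(1)[of k] by simp
  have ratio: "(\<lambda>k. \<alpha> (k + l) / \<alpha> (k + B)) \<longlonglongrightarrow> 1" for l
  proof -
    have "(\<lambda>k. (\<alpha> (k + l) / \<alpha> k) / (\<alpha> (k + B) / \<alpha> k)) \<longlonglongrightarrow> 1 / 1"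
      by (intro tendsto_divide ratio_shift_tendsto_1 \<alpha>) auto
    then show ?thesis using nz by simp
  qed
  have "(\<lambda>k. q * (\<alpha> (k + 0) / \<alpha> (k + B))) \<longlonglongrightarrow> q * 1" by (intro tendsto_mult tendsto_const ratio)
  then have "\<forall>\<^sub>F k in sequentially. q * (\<alpha> (k + 0) / \<alpha> (k + B)) < q'"
    using q' by (intro order_tendstoD(2)) auto
  moreover have "(\<lambda>k. C * (\<Sum>l<B. \<alpha> (k + l) / \<alpha> (k + B))) \<longlonglongrightarrow> C * (\<Sum>l<B. 1)"
    by (intro tendsto_mult tendsto_const tendsto_sum ratio)
  then have "\<forall>\<^sub>F k in sequentially. C * (\<Sum>l<B. \<alpha> (k + l) / \<alpha> (k + B)) < C * real B + 1"
    by (rule order_tendstoD(2)) simp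
  ultimately have "\<forall>\<^sub>F k in sequentially. r (k + B) \<le> q' * r k + (C * real B + 1)"
  proof eventually_elim
    case (elim k)
    have "r (k + B) \<le> (q * D k + C * (\<Sum>l<B. \<alpha> (k + l))) / \<alpha> (k + B)"
      unfolding r_def using rec[of k] \<alpha>(1)[of "k + B"] by (intro divide_right_mono) auto
    also have "\<dots> = q * (\<alpha> (k + 0) / \<alpha> (k + B)) * r k + C * (\<Sum>l<B. \<alpha> (k + l) / \<alpha> (k + B))"
      using nz by (simp add: r_def add_divide_distrib flip: sum_divide_distrib)
    also have "\<dots> \<le> q' * r k + (C * real B + 1)"
      using elim D[of k] \<alpha>(1)[of k] by (intro add_mono mult_right_mono) (auto simp: r_def)
    finally show ?case .
  qed
  then obtain K where "\<And>k. K \<le> k \<Longrightarrow> r (k + B) \<le> q' * r k + (C * real B + 1)"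
    by (auto simp: eventually_sequentially)
  moreover have "0 \<le> r k" for k using D[of k] \<alpha>(1)[of k] by (simp add: r_def)
  ultimately obtain M where M: "\<And>k. r k \<le> M"
    using contracting_sequence_bounded[of q' r K B "C * real B + 1"] q' B C by auto
  have "D k \<le> M * \<alpha> k" for k
    using M[of k] \<alpha>(1)[of k] by (simp add: r_def pos_divide_le_eq)
  then show ?thesis by blast
qed

section \<open>The descent inequality\<close>

lemma norm_sq_add:
  fixes a b :: "'a::real_inner"
  shows "(norm (a + b))\<^sup>2 = (norm a)\<^sup>2 + 2 * (a \<bullet> b) + (norm b)\<^sup>2"
  unfolding power2_norm_eq_inner by (simp add: inner_add_left inner_add_right inner_commute)

lemma weighted_norm_sq_decomposition:
  fixes y :: "'m::finite \<Rightarrow> 'a::real_inner"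
  assumes a: "(\<Sum>j\<in>UNIV. a j) = 1"
  defines "m \<equiv> \<Sum>j\<in>UNIV. a j *\<^sub>R y j"
  shows "(\<Sum>j\<in>UNIV. a j * (norm (y j - z))\<^sup>2)
    = (norm (m - z))\<^sup>2 + (\<Sum>j\<in>UNIV. a j * (norm (y j - m))\<^sup>2)"
proof -
  have expand: "(norm (y j - z))\<^sup>2
      = (norm (y j - m))\<^sup>2 + 2 * ((y j - m) \<bullet> (m - z)) + (norm (m - z))\<^sup>2" for j
    using norm_sq_add[of "y j - m" "m - z"] by simp
  have "(\<Sum>j\<in>UNIV. a j *\<^sub>R (y j - m)) = 0"
    using a by (simp add: scaleR_diff_right sum_subtractf m_def flip: scaleR_left.sum)
  then have cross: "(\<Sum>j\<in>UNIV. a j * ((y j - m) \<bullet> (m - z))) = 0"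
    by (simp flip: inner_scaleR_left inner_sum_left)
  have "(\<Sum>j\<in>UNIV. a j * (norm (y j - z))\<^sup>2)
      = (\<Sum>j\<in>UNIV. a j * (norm (y j - m))\<^sup>2)
        + 2 * (\<Sum>j\<in>UNIV. a j * ((y j - m) \<bullet> (m - z))) + (\<Sum>j\<in>UNIV. a j) * (norm (m - z))\<^sup>2"
    unfolding expand sum_distrib_left sum_distrib_right sum.distrib[symmetric]
    by (intro sum.cong refl) (simp add: algebra_simps)
  then show ?thesis using cross a by simp
qed

lemma norm_sq_weighted_le:
  fixes y :: "'m::finite \<Rightarrow> 'a::real_inner"
  assumes "(\<Sum>j\<in>UNIV. a j) = 1" "\<And>j. 0 \<le> a j"
  shows "(norm ((\<Sum>j\<in>UNIV. a j *\<^sub>R y j) - z))\<^sup>2 \<le> (\<Sum>j\<in>UNIV. a j * (norm (y j - z))\<^sup>2)"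
  using weighted_norm_sq_decomposition[OF assms(1), of y z] assms(2) by (simp add: sum_nonneg)

lemma agent_mean_eq_weighted:
  fixes y :: "'m::finite \<Rightarrow> 'a::real_vector"
  shows "agent_mean y = (\<Sum>i\<in>UNIV. (1 / real CARD('m)) *\<^sub>R y i)"
  by (simp add: agent_mean_def scaleR_right.sum)

lemma agent_mean_affine:
  fixes y z :: "'m::finite \<Rightarrow> real"
  shows "agent_mean (\<lambda>i. a * y i + b * z i + c) = a * agent_mean y + b * agent_mean z + c"
  by (simp add: agent_mean_def sum.distrib add_divide_distrib flip: sum_distrib_left)

lemma agent_mean_mono:
  fixes y z :: "'m::finite \<Rightarrow> real"
  assumes "\<And>i. y i \<le> z i"
  shows "agent_mean y \<le> agent_mean z"
  using assms by (auto simp: agent_mean_def intro!: divide_right_mono sum_mono)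

lemma norm_sq_agent_mean_le:
  fixes y :: "'m::finite \<Rightarrow> 'a::real_inner"
  shows "(norm (agent_mean y - z))\<^sup>2 \<le> agent_mean (\<lambda>i. (norm (y i - z))\<^sup>2)"
  using norm_sq_weighted_le[of "\<lambda>_. 1 / real CARD('m)" y z]
  unfolding agent_mean_eq_weighted by simp

lemma agent_mean_in_convex:
  fixes y :: "'m::finite \<Rightarrow> 'a::real_vector"
  assumes "convex X" "\<And>i. y i \<in> X"
  shows "agent_mean y \<in> X"
  unfolding agent_mean_eq_weighted using assms by (intro convex_sum) auto

lemma norm_diff_agent_mean_le:
  fixes y :: "'m::finite \<Rightarrow> 'a::real_normed_vector"
  assumes "\<And>i. norm (y i - z) \<le> c"
  shows "norm (agent_mean y - z) \<le> c"
  unfolding agent_mean_eq_weighted by (rule norm_convex_combination_diff_le) (use assms in auto)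

lemma norm_agent_mean_diff_le_disagreement:
  fixes y :: "'m::finite \<Rightarrow> 'a::real_normed_vector"
  shows "norm (y i - agent_mean y) \<le> disagreement y"
  using norm_diff_agent_mean_le[of y "y i" "disagreement y"] norm_diff_le_disagreement[of y _ i]
  by (simp add: norm_minus_commute)

text \<open>A bound on the subgradients at \<open>x\<close> limits how far a weakly convex function can fall below
  its value at \<open>x\<close>.\<close>

lemma weakly_convex_lower_bound:
  fixes f :: "'a::euclidean_space \<Rightarrow> real"
  assumes f: "weakly_convex \<rho> f" and L: "\<And>s. s \<in> weak_subdiff \<rho> f x \<Longrightarrow> norm s \<le> L"
  shows "f x - L * norm (y - x) - \<rho> / 2 * (norm (y - x))\<^sup>2 \<le> f y"
proof -
  obtain s where s: "s \<in> weak_subdiff \<rho> f x"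
    using weak_subdiff_nonempty[OF f] by blast
  have "- (s \<bullet> (y - x)) \<le> norm s * norm (y - x)"
    using Cauchy_Schwarz_ineq2[of s "y - x"] by linarith
  also have "\<dots> \<le> L * norm (y - x)" using L[OF s] by (rule mult_right_mono) simp
  finally show ?thesis using weak_subdiff_lower_bound[OF s, of y] by linarith
qed

lemma agent_mean_lower_bound:
  fixes fi :: "'m::finite \<Rightarrow> 'a::euclidean_space \<Rightarrow> real"
  assumes f: "\<And>i. weakly_convex \<rho> (fi i)"
    and L: "\<And>i s. s \<in> weak_subdiff \<rho> (fi i) x \<Longrightarrow> norm s \<le> L"
  shows "agent_mean (\<lambda>i. fi i x) - L * norm (y - x) - \<rho> / 2 * (norm (y - x))\<^sup>2
    \<le> agent_mean (\<lambda>i. fi i y)"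
proof -
  let ?c = "- L * norm (y - x) - \<rho> / 2 * (norm (y - x))\<^sup>2"
  have "agent_mean (\<lambda>i. 1 * fi i x + 0 * 0 + ?c) \<le> agent_mean (\<lambda>i. fi i y)"
  proof (rule agent_mean_mono)
    fix i
    show "1 * fi i x + 0 * 0 + ?c \<le> fi i y"
      using weakly_convex_lower_bound[of \<rho> "fi i" x L y] f L by simp
  qed
  then show ?thesis by (simp only: agent_mean_affine)
qed

lemma is_prox_dist_le:
  assumes p: "is_prox t f X x p" and x: "x \<in> X"
    and low: "f x - L * norm (p - x) - \<rho> / 2 * (norm (p - x))\<^sup>2 \<le> f p"
    and t: "0 < t" "t < 1 / (2 * \<rho>)" and \<rho>: "0 < \<rho>" and L: "0 \<le> L"
  shows "norm (p - x) \<le> 4 * t * L"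
proof (cases "p = x")
  case True
  then show ?thesis using t L by simp
next
  case False
  let ?d = "norm (p - x)"
  have "f p + 1 / (2 * t) * ?d\<^sup>2 \<le> f x" using is_prox_le[OF p x] by simp
  with low have 1: "1 / (2 * t) * ?d\<^sup>2 - \<rho> / 2 * ?d\<^sup>2 \<le> L * ?d" by linarith
  have "\<rho> \<le> 1 / (2 * t)" using t \<rho> by (simp add: field_simps)
  then have "\<rho> / 2 * ?d\<^sup>2 \<le> 1 / (2 * t) / 2 * ?d\<^sup>2" by (intro mult_right_mono) auto
  with 1 have "1 / (4 * t) * ?d * ?d \<le> L * ?d" by (simp add: power2_eq_square)
  then have "1 / (4 * t) * ?d \<le> L" by (rule mult_right_le_imp_le) (use False in simp)
  then show ?thesis using t by (simp add: field_simps)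
qed

lemma moreau_envelope_diff_le:
  fixes X :: "'a::real_inner set"
  defines "\<Phi> f t \<equiv> moreau_envelope t (\<lambda>y. ereal (f y) + ext_indicator X y)"
  assumes p: "is_prox t f X x p" "norm (p - x) \<le> 4 * t * L"
    and q: "is_prox t f X y q" "norm (q - y) \<le> 4 * t * L" and t: "0 < t"
  shows "\<bar>\<Phi> f t y - \<Phi> f t x\<bar> \<le> 4 * L * norm (y - x) + 1 / (2 * t) * (norm (y - x))\<^sup>2"
proof -
  have le: "1 / t * ((b - a) \<bullet> (a - r)) \<le> 4 * L * norm (b - a)"
    if "norm (r - a) \<le> 4 * t * L" for a b r :: 'a
  proof -
    have "(b - a) \<bullet> (a - r) \<le> norm (b - a) * norm (r - a)"
      using norm_cauchy_schwarz[of "b - a" "a - r"] by (simp add: norm_minus_commute)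
    also have "\<dots> \<le> norm (b - a) * (4 * t * L)" using that by (rule mult_left_mono) simp
    finally show ?thesis using t by (simp add: field_simps)
  qed
  have "\<Phi> f t y - \<Phi> f t x \<le> 4 * L * norm (y - x) + 1 / (2 * t) * (norm (y - x))\<^sup>2"
    using moreau_envelope_quadratic_upper[OF p(1) q(1)] le[OF p(2), of y] unfolding \<Phi>_def by linarith
  moreover have "\<Phi> f t x - \<Phi> f t y \<le> 4 * L * norm (y - x) + 1 / (2 * t) * (norm (y - x))\<^sup>2"
    using moreau_envelope_quadratic_upper[OF q(1) p(1)] le[OF q(2), of x]
    unfolding \<Phi>_def norm_minus_commute[of y x] by linarith
  ultimately show ?thesis by linarith
qed

text \<open>One round of the method, from the points \<open>u i\<close> to the points \<open>w i\<close>: the proximal point \<open>p\<close>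
  of the old mean is a competitor in the minimization defining the Moreau envelope at the new
  mean.\<close>

lemma moreau_envelope_descent:
  fixes X :: "'a::euclidean_space set" and fi :: "'m::finite \<Rightarrow> 'a \<Rightarrow> real"
    and u v w g :: "'m \<Rightarrow> 'a" and P :: "real^'m^'m"
  defines "f \<equiv> (\<lambda>y. agent_mean (\<lambda>i. fi i y))"
    and "\<Phi> t f \<equiv> moreau_envelope t (\<lambda>y. ereal (f y) + ext_indicator X y)"
    and "D \<equiv> disagreement u"
  assumes X: "closed X" "convex X" and P: "doubly_stochastic P"
    and wc: "\<And>i. weakly_convex \<rho> (fi i)"
    and L: "\<And>i y s. y \<in> X \<Longrightarrow> s \<in> weak_subdiff \<rho> (fi i) y \<Longrightarrow> norm s \<le> L" "0 \<le> L"
    and u: "\<And>i. u i \<in> X"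
    and v: "\<And>i. v i = (\<Sum>j\<in>UNIV. (P $ i $ j) *\<^sub>R u j)"
    and g: "\<And>i. g i \<in> weak_subdiff \<rho> (fi i) (v i)"
    and w: "\<And>i. w i = closest_point X (v i - a *\<^sub>R g i)"
    and t: "0 < t" and a: "0 \<le> a"
    and p: "is_prox t f X (agent_mean u) p" and q: "is_prox t f X (agent_mean w) q"
  shows "\<Phi> t f (agent_mean w) \<le> \<Phi> t f (agent_mean u)
    - a / t * (1 / t - \<rho>) * (norm (p - agent_mean u))\<^sup>2
    + 1 / (2 * t) * (D\<^sup>2 + 2 * a * (L * D + \<rho> * D\<^sup>2)) + L\<^sup>2 * a\<^sup>2 / (2 * t)"
proof -
  let ?u = "agent_mean u" and ?w = "agent_mean w"
  define d where "d = norm (p - ?u)"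
  have \<rho>: "0 < \<rho>" using wc by (auto simp: weakly_convex_def)
  have D0: "0 \<le> D" by (simp add: D_def disagreement_nonneg)
  have pX: "p \<in> X" using p by (simp add: is_prox_def)
  have uX: "?u \<in> X" using X(2) u by (rule agent_mean_in_convex)
  have vX: "v i \<in> X" for i
    unfolding v by (rule convex_sum) (auto simp: X u doubly_stochasticD[OF P])
  have v_mean: "norm (v i - ?u) \<le> D" for i
    unfolding v D_def using doubly_stochasticD[OF P]
    by (intro norm_convex_combination_diff_le norm_agent_mean_diff_le_disagreement)
  have step: "(norm (w i - p))\<^sup>2 \<le> (1 + a * \<rho>) * (norm (v i - p))\<^sup>2
      + 2 * a * (fi i p - fi i ?u) + (2 * a * (L * D + \<rho> / 2 * D\<^sup>2) + a\<^sup>2 * L\<^sup>2)" for i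
  proof -
    have "norm (w i - p) \<le> norm ((v i - p) + (- a *\<^sub>R g i))"
      using closest_point_lipschitz[OF X(2,1), of "v i - a *\<^sub>R g i" p] pX
      by (auto simp: w closest_point_self dist_norm algebra_simps)
    then have "(norm (w i - p))\<^sup>2 \<le> (norm ((v i - p) + (- a *\<^sub>R g i)))\<^sup>2"
      by (rule power_mono) simp
    also have "\<dots> = (norm (v i - p))\<^sup>2 + 2 * a * (g i \<bullet> (p - v i)) + a\<^sup>2 * (norm (g i))\<^sup>2"
      unfolding norm_sq_add
      by (simp add: power_mult_distrib inner_diff_left inner_diff_right inner_commute algebra_simps)
    also have "\<dots> \<le> (norm (v i - p))\<^sup>2
        + 2 * a * (fi i p - fi i ?u + L * D + \<rho> / 2 * D\<^sup>2 + \<rho> / 2 * (norm (v i - p))\<^sup>2) + a\<^sup>2 * L\<^sup>2"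
    proof (intro add_mono mult_left_mono order_refl power_mono)
      have "fi i (v i) + g i \<bullet> (p - v i) - \<rho> / 2 * (norm (v i - p))\<^sup>2 \<le> fi i p"
        using weak_subdiff_lower_bound[OF g, of i p] by (simp add: norm_minus_commute)
      moreover have "fi i ?u - L * norm (v i - ?u) - \<rho> / 2 * (norm (v i - ?u))\<^sup>2 \<le> fi i (v i)"
        using wc L(1)[OF uX] by (rule weakly_convex_lower_bound)
      moreover have "L * norm (v i - ?u) \<le> L * D"
        using v_mean L(2) by (rule mult_left_mono)
      moreover have "\<rho> / 2 * (norm (v i - ?u))\<^sup>2 \<le> \<rho> / 2 * D\<^sup>2"
        using v_mean \<rho> by (intro mult_left_mono power_mono) auto
      ultimately show "g i \<bullet> (p - v i)
          \<le> fi i p - fi i ?u + L * D + \<rho> / 2 * D\<^sup>2 + \<rho> / 2 * (norm (v i - p))\<^sup>2"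
        by linarith
    qed (use a L(1)[OF vX g] in auto)
    finally show ?thesis by (simp add: algebra_simps)
  qed
  \<comment> \<open>the columns of \<open>P\<close> sum to 1, so mixing does not increase the mean squared distance to \<open>p\<close>\<close>
  have mixing: "agent_mean (\<lambda>i. (norm (v i - p))\<^sup>2) \<le> d\<^sup>2 + D\<^sup>2"
  proof -
    have "(\<Sum>i\<in>UNIV. (norm (v i - p))\<^sup>2) \<le> (\<Sum>i\<in>UNIV. \<Sum>j\<in>UNIV. P $ i $ j * (norm (u j - p))\<^sup>2)"
      unfolding v by (intro sum_mono norm_sq_weighted_le doubly_stochasticD[OF P])
    also have "\<dots> = (\<Sum>j\<in>UNIV. (norm (u j - p))\<^sup>2)"
      using doubly_stochasticD(3)[OF P] by (subst sum.swap) (simp flip: sum_distrib_right)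
    finally have "agent_mean (\<lambda>i. (norm (v i - p))\<^sup>2) \<le> agent_mean (\<lambda>j. (norm (u j - p))\<^sup>2)"
      unfolding agent_mean_def by (intro scaleR_left_mono) auto
    also have "\<dots> = (norm (?u - p))\<^sup>2 + agent_mean (\<lambda>j. (norm (u j - ?u))\<^sup>2)"
      using weighted_norm_sq_decomposition[of "\<lambda>_::'m. 1 / real CARD('m)" u p]
      unfolding agent_mean_eq_weighted by simp
    also have "agent_mean (\<lambda>j. (norm (u j - ?u))\<^sup>2) \<le> agent_mean (\<lambda>j::'m. D\<^sup>2)"
      unfolding D_def by (intro agent_mean_mono power_mono norm_agent_mean_diff_le_disagreement norm_ge_zero)
    also have "\<dots> = D\<^sup>2" by (simp add: agent_mean_def)
    finally show ?thesis by (simp add: d_def norm_minus_commute)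
  qed
  have wcf: "weakly_convex \<rho> f" unfolding f_def by (rule weakly_convex_agent_mean) (rule wc)
  have objective: "f p - f ?u \<le> - (1 / t - \<rho> / 2) * d\<^sup>2"
    using is_prox_quadratic_growth[OF p wcf X(2) uX]
    by (simp add: d_def norm_minus_commute algebra_simps diff_divide_distrib)
  have "(norm (?w - p))\<^sup>2 \<le> agent_mean (\<lambda>i. (norm (w i - p))\<^sup>2)"
    by (rule norm_sq_agent_mean_le)
  also have "\<dots> \<le> agent_mean (\<lambda>i. (1 + a * \<rho>) * (norm (v i - p))\<^sup>2
      + 2 * a * (fi i p - fi i ?u) + (2 * a * (L * D + \<rho> / 2 * D\<^sup>2) + a\<^sup>2 * L\<^sup>2))"
    by (rule agent_mean_mono) (rule step)
  also have "\<dots> = (1 + a * \<rho>) * agent_mean (\<lambda>i. (norm (v i - p))\<^sup>2)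
      + 2 * a * (f p - f ?u) + (2 * a * (L * D + \<rho> / 2 * D\<^sup>2) + a\<^sup>2 * L\<^sup>2)"
    unfolding agent_mean_affine
    by (simp add: f_def agent_mean_def sum_subtractf diff_divide_distrib)
  also have "\<dots> \<le> (1 + a * \<rho>) * (d\<^sup>2 + D\<^sup>2)
      + 2 * a * (- (1 / t - \<rho> / 2) * d\<^sup>2) + (2 * a * (L * D + \<rho> / 2 * D\<^sup>2) + a\<^sup>2 * L\<^sup>2)"
    using mixing objective a \<rho> by (intro add_mono mult_left_mono order_refl) auto
  also have "\<dots> = d\<^sup>2 - 2 * a * (1 / t - \<rho>) * d\<^sup>2 + (D\<^sup>2 + 2 * a * (L * D + \<rho> * D\<^sup>2)) + L\<^sup>2 * a\<^sup>2"
    by (simp add: algebra_simps)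
  finally have "1 / (2 * t) * (norm (p - ?w))\<^sup>2 \<le> 1 / (2 * t) * \<dots>"
    using t by (intro mult_left_mono) (auto simp: norm_minus_commute)
  also have "\<dots> = 1 / (2 * t) * d\<^sup>2 - a / t * (1 / t - \<rho>) * d\<^sup>2
      + 1 / (2 * t) * (D\<^sup>2 + 2 * a * (L * D + \<rho> * D\<^sup>2)) + L\<^sup>2 * a\<^sup>2 / (2 * t)"
  proof -
    have "1 / (2 * t) * (A - 2 * a * B * A + C + E)
        = 1 / (2 * t) * A - a / t * B * A + 1 / (2 * t) * C + E / (2 * t)" for A B C E
      using t by (simp add: field_simps)
    then show ?thesis .
  qed
  finally show ?thesis
    using is_prox_le[OF q pX] unfolding \<Phi>_def moreau_envelope_prox[OF p] moreau_envelope_prox[OF q]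
      d_def[symmetric] by linarith
qed

section \<open>Sequences with a descent inequality\<close>

lemma almost_decreasing_convergent:
  fixes u e :: "nat \<Rightarrow> real"
  assumes step: "\<And>k. u (Suc k) \<le> u k + e k" and e: "summable e" "\<And>k. 0 \<le> e k" and low: "\<And>k. B \<le> u k"
  shows "\<exists>l. u \<longlonglongrightarrow> l"
proof -
  let ?w = "\<lambda>n. u n - (\<Sum>k<n. e k)"
  have "decseq ?w"
    by (rule decseq_SucI) (use step in \<open>simp add: algebra_simps\<close>)
  moreover have "B - suminf e \<le> ?w n" for n
    using low[of n] sum_le_suminf[OF e(1), of "{..<n}"] e(2) by simp
  ultimately obtain l where "?w \<longlonglongrightarrow> l" using decseq_convergent[of ?w "B - suminf e"] by blast
  then have "(\<lambda>n. ?w n + (\<Sum>k<n. e k)) \<longlonglongrightarrow> l + suminf e"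
    by (intro tendsto_add summable_LIMSEQ e)
  then show ?thesis by auto
qed

lemma descent_INF_le:
  fixes u e G \<alpha> :: "nat \<Rightarrow> real"
  assumes step: "\<And>k. u (Suc k) \<le> u k - c * (\<alpha> k * G k) + e k" and low: "\<And>k. m \<le> u k"
    and c: "0 < c" and G: "\<And>k. 0 \<le> G k" and \<alpha>: "\<And>k. 0 < \<alpha> k"
  shows "(INF k\<in>{..K}. G k) \<le> 1 / c * ((u 0 - m + (\<Sum>k\<le>K. e k)) / (\<Sum>k\<le>K. \<alpha> k))"
proof -
  let ?I = "INF k\<in>{..K}. G k"
  have tele: "u (Suc n) \<le> u 0 - c * (\<Sum>k\<le>n. \<alpha> k * G k) + (\<Sum>k\<le>n. e k)" for n
  proof (induction n)
    case 0
    then show ?case using step[of 0] by simp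
  next
    case (Suc n)
    then show ?case using step[of "Suc n"] by (simp add: algebra_simps)
  qed
  have "?I * (\<Sum>k\<le>K. \<alpha> k) = (\<Sum>k\<le>K. \<alpha> k * ?I)" by (subst sum_distrib_left) (simp only: mult.commute)
  also have "\<dots> \<le> (\<Sum>k\<le>K. \<alpha> k * G k)"
    using \<alpha> by (intro sum_mono mult_left_mono cINF_lower) (auto intro: less_imp_le)
  finally have "c * (?I * (\<Sum>k\<le>K. \<alpha> k)) \<le> c * (\<Sum>k\<le>K. \<alpha> k * G k)"
    using c by simp
  then have "c * (?I * (\<Sum>k\<le>K. \<alpha> k)) \<le> u 0 - m + (\<Sum>k\<le>K. e k)"
    using tele[of K] low[of "Suc K"] by linarith
  moreover have "0 < (\<Sum>k\<le>K. \<alpha> k)" using \<alpha> by (intro sum_pos) auto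
  ultimately show ?thesis using c by (simp add: field_simps)
qed

text \<open>If the infimum were positive, then, as \<open>\<alpha>\<close> tends to 0, the error \<open>C * (\<alpha> k)\<^sup>2\<close> would
  eventually be absorbed by half of the decrease, and the divergence of \<open>\<Sum>\<alpha>\<close> would drive \<open>u\<close>
  below its lower bound.\<close>

lemma descent_INF_eq_0:
  fixes u e G \<alpha> :: "nat \<Rightarrow> real"
  assumes step: "\<And>k. u (Suc k) \<le> u k - c * (\<alpha> k * G k) + C * (\<alpha> k)\<^sup>2" and low: "\<And>k. m \<le> u k"
    and c: "0 < c" and G: "\<And>k. 0 \<le> G k"
    and \<alpha>: "\<And>k. 0 < \<alpha> k" "\<alpha> \<longlonglongrightarrow> 0" "filterlim (\<lambda>n. \<Sum>k<n. \<alpha> k) at_top sequentially"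
  shows "(INF k. G k) \<le> 0"
proof (rule ccontr)
  define h where "h = c * (INF k. G k) / 2"
  assume "\<not> (INF k. G k) \<le> 0"
  then have h: "0 < h" using c by (simp add: h_def)
  have le: "2 * h \<le> c * G k" for k
    using c G unfolding h_def by (auto intro!: mult_left_mono cINF_lower bdd_belowI[of _ 0])
  have "(\<lambda>k. C * \<alpha> k) \<longlonglongrightarrow> C * 0" by (intro tendsto_intros \<alpha>)
  then have "\<forall>\<^sub>F k in sequentially. C * \<alpha> k < h" using h by (intro order_tendstoD(2)) auto
  then obtain K where K: "\<And>k. K \<le> k \<Longrightarrow> C * \<alpha> k < h" by (auto simp: eventually_sequentially)
  have dec: "u (Suc k) \<le> u k - h * \<alpha> k" if "K \<le> k" for k
  proof -
    have "2 * h * \<alpha> k \<le> c * G k * \<alpha> k" using le \<alpha>(1)[of k] by (intro mult_right_mono) auto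
    moreover have "C * \<alpha> k * \<alpha> k \<le> h * \<alpha> k" using K[OF that] \<alpha>(1)[of k] by (intro mult_right_mono) auto
    ultimately show ?thesis using step[of k] by (simp add: power2_eq_square algebra_simps)
  qed
  have tele: "u n + h * (\<Sum>k<n. \<alpha> k) \<le> u K + h * (\<Sum>k<K. \<alpha> k)" if "K \<le> n" for n
    using that
  proof (induction n rule: dec_induct)
    case (step n)
    then show ?case using dec[of n] by (simp add: algebra_simps)
  qed simp
  let ?R = "(u K + h * (\<Sum>k<K. \<alpha> k) - m) / h"
  have "\<forall>\<^sub>F n in sequentially. ?R < (\<Sum>k<n. \<alpha> k)" using \<alpha>(3) by (simp add: filterlim_at_top_dense)
  moreover have "\<forall>\<^sub>F n in sequentially. K \<le> n" by (rule eventually_ge_at_top)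
  ultimately have "\<forall>\<^sub>F n in sequentially. False"
  proof eventually_elim
    case (elim n)
    then have "u K + h * (\<Sum>k<K. \<alpha> k) - m < h * (\<Sum>k<n. \<alpha> k)" using h by (simp add: field_simps)
    then show False using tele[OF elim(2)] low[of n] by linarith
  qed
  then show False by simp
qed

lemma suminf_ereal_diverges:
  fixes \<alpha> :: "nat \<Rightarrow> real"
  assumes "filterlim (\<lambda>n. \<Sum>k<n. \<alpha> k) at_top sequentially"
  shows "(\<Sum>k. ereal (\<alpha> k)) = \<infinity>"
proof -
  have "(\<lambda>k. ereal (\<alpha> k)) sums \<infinity>"
    using assms by (simp add: sums_def tendsto_PInfty_eq_at_top)
  then show ?thesis by (rule sums_unique[symmetric])
qed


section \<open>Convergence of the distributed projected subgradient method\<close>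

theorem mainTheorem2:
  fixes X :: "(real^'n) set"
    and fi :: "'m::finite \<Rightarrow> real^'n \<Rightarrow> real"
    and f :: "real^'n \<Rightarrow> real"
    and \<phi>t :: "real^'n \<Rightarrow> real"
    and A :: "nat \<Rightarrow> real^'m^'m"
    and \<alpha> :: "nat \<Rightarrow> real"
    and x g :: "'m \<Rightarrow> nat \<Rightarrow> real^'n"
    and xbar :: "nat \<Rightarrow> real^'n"
    and \<rho> L \<eta> t :: real
    and T0 :: nat
  defines "f \<equiv> (\<lambda>y. agent_mean (\<lambda>i. fi i y))"
    and "\<phi>t \<equiv> moreau_envelope t (\<lambda>y. ereal (f y) + ext_indicator X y)"
    and "xbar \<equiv> (\<lambda>k. agent_mean (\<lambda>i. x i k))"
  assumes X: "closed X" "convex X"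
    and A1: "0 < \<eta>" "\<eta> < 1"
      "\<And>k i. A k $ i $ i \<ge> \<eta>"
      "\<And>k i j. A k $ i $ j > 0 \<Longrightarrow> A k $ i $ j \<ge> \<eta>"
    and A2: "\<And>k. doubly_stochastic (A k)"
    and A3: "strongly_connected_edges (comm_edges_inf A)"
    and A4: "T0 \<ge> 1"
      "\<And>e k. e \<in> comm_edges_inf A \<Longrightarrow> e \<in> (\<Union>m\<in>{k..<k + T0}. comm_edges A m)"
    and A5: "bdd_below (range f)"
      "\<And>i. weakly_convex \<rho> (fi i)"
      "\<And>i y s. y \<in> X \<Longrightarrow> s \<in> weak_subdiff \<rho> (fi i) y \<Longrightarrow> norm s \<le> L"
    and A6: "\<And>k. \<alpha> k > 0"
      "filterlim (\<lambda>n. \<Sum>k<n. \<alpha> k) at_top sequentially"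
      "\<alpha> \<longlonglongrightarrow> 0"
      "(\<lambda>k. \<alpha> (Suc k) / \<alpha> k) \<longlonglongrightarrow> 1"
    and t: "0 < t" "t < 1 / (2 * \<rho>)"
    and alg: "dist_proj_subgrad X \<rho> fi A \<alpha> g x"
  shows "(summable (\<lambda>k. (\<alpha> k)\<^sup>2) \<longrightarrow>
           (\<exists>\<phi>bar. (\<forall>i. (\<lambda>k. \<phi>t (x i k)) \<longlonglongrightarrow> \<phi>bar) \<and> (\<lambda>k. \<phi>t (xbar k)) \<longlonglongrightarrow> \<phi>bar))
       \<and> (\<forall>c lam. consensus_rate A c lam \<longrightarrow>
           (\<exists>b. b \<in> O(\<lambda>k. L\<^sup>2 * (\<alpha> k)\<^sup>2 / (1 - lam)\<^sup>2) \<and> (\<forall>k. 0 \<le> b k) \<and>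
             (\<forall>K. (INF k\<in>{..K}. (norm (gradient \<phi>t (xbar k)))\<^sup>2)
                \<le> 2 / (1 - 2 * t * \<rho>) *
                  ((\<phi>t (xbar 0) - (INF y. \<phi>t y) + (\<Sum>k\<le>K. b k) + (\<Sum>k\<le>K. L\<^sup>2 * (\<alpha> k)\<^sup>2 / (2 * t)))
                   / (\<Sum>k\<le>K. \<alpha> k))) \<and>
             ereal (INF k. (norm (gradient \<phi>t (xbar k)))\<^sup>2)
                \<le> ereal (2 / (1 - 2 * t * \<rho>)) *
                  ((ereal (\<phi>t (xbar 0) - (INF y. \<phi>t y)) + (\<Sum>k. ereal (b k))
                      + (\<Sum>k. ereal (L\<^sup>2 * (\<alpha> k)\<^sup>2 / (2 * t))))
                   / (\<Sum>k. ereal (\<alpha> k)))))"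
proof -
  have wcf: "weakly_convex \<rho> f" unfolding f_def by (rule weakly_convex_agent_mean) (rule A5(2))
  have \<rho>: "0 < \<rho>" using wcf by (simp add: weakly_convex_def)
  have t': "t < 1 / \<rho>" using t \<rho> by (simp add: field_simps)
  \<comment> \<open>the coefficient of \<open>\<alpha> k * (norm (gradient \<phi>t (xbar k)))\<^sup>2\<close> in the decrease is at least \<open>c\<close>\<close>
  define c where "c = (1 - 2 * t * \<rho>) / 2"
  have c: "0 < c" using t \<rho> by (simp add: c_def field_simps)
  have \<phi>t_eq: "\<phi>t = moreau_envelope t (\<lambda>y. ereal (f y) + ext_indicator X y)"
    by (simp add: \<phi>t_def)

  define v where "v = mixed_point A x"
  have v: "v i k = (\<Sum>j\<in>UNIV. (A k $ i $ j) *\<^sub>R x j k)" for i k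
    unfolding v_def mixed_point_def
    by (rule sum.mono_neutral_left) (use doubly_stochasticD(1)[OF A2] in \<open>auto simp: antisym_conv1 order.order_iff_strict\<close>)
  have x0: "x i 0 \<in> X" and g: "g i k \<in> weak_subdiff \<rho> (fi i) (v i k)"
    and x_Suc: "x i (Suc k) = closest_point X (v i k - \<alpha> k *\<^sub>R g i k)" for i k
    using alg by (auto simp: dist_proj_subgrad_def v_def)
  have X_ne: "X \<noteq> {}" using x0 by blast
  have xX: "x i k \<in> X" for i k
    by (cases k) (auto simp: x0 x_Suc closest_point_in_set X X_ne)
  have vX: "v i k \<in> X" for i k
    unfolding v by (rule convex_sum) (auto simp: X xX doubly_stochasticD[OF A2])
  have xbarX: "xbar k \<in> X" for k
    unfolding xbar_def by (rule agent_mean_in_convex) (auto simp: X xX)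
  have gL: "norm (g i k) \<le> L" for i k using A5(3)[OF vX g] .
  have L: "0 \<le> L" using gL[of undefined 0] norm_ge_zero order_trans by blast

  define D where "D k = disagreement (\<lambda>i. x i k)" for k
  have D0: "0 \<le> D k" for k by (simp add: D_def disagreement_nonneg)
  have perturbation: "norm (x i (Suc k) - (\<Sum>j\<in>UNIV. (A k $ i $ j) *\<^sub>R x j k)) \<le> \<alpha> k * L" for i k
  proof -
    have "norm (x i (Suc k) - v i k) \<le> norm (\<alpha> k *\<^sub>R g i k)"
      using closest_point_lipschitz[OF X(2,1) X_ne, of "v i k - \<alpha> k *\<^sub>R g i k" "v i k"]
      by (simp add: x_Suc closest_point_self[OF vX] dist_norm)
    also have "\<dots> \<le> \<alpha> k * L" using gL[of i k] A6(1)[of k] by simp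
    finally show ?thesis by (simp add: v)
  qed
  obtain M where M: "\<And>k. D k \<le> M * \<alpha> k"
  proof -
    obtain n where n: "0 < n" "\<And>k i j. \<eta> ^ n \<le> window_product A k n $ i $ j"
      using window_product_scrambling[OF A2 A1(1,3,4) A3 A4(2)] by blast
    have rec: "D (k + n) \<le> (1 - (\<eta> ^ n)\<^sup>2) * D k + 2 * L * (\<Sum>l<n. \<alpha> (k + l))" for k
      using perturbed_averaging_disagreement[where y = x, OF A2 perturbation _ n(2), of k] A1(1)
      by (simp add: D_def mult_ac flip: sum_distrib_left)
    have "\<eta> ^ n \<le> 1" using A1 by (intro power_le_one) auto
    then have q: "0 \<le> 1 - (\<eta> ^ n)\<^sup>2" "1 - (\<eta> ^ n)\<^sup>2 < 1"
      using A1(1) by (auto simp: abs_square_le_1)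
    show ?thesis
      using perturbed_contraction_le_stepsize[OF A6(1,4) D0 rec q _ n(1)] L that by fastforce
  qed
  have M0: "0 \<le> M"
    using order_trans[OF D0 M, of 0] A6(1)[of 0] by (simp add: zero_le_mult_iff)
  have dist_mean: "norm (x i k - xbar k) \<le> D k" for i k
    unfolding xbar_def D_def by (rule norm_agent_mean_diff_le_disagreement)

  have "\<forall>y. \<exists>p. is_prox t f X y p"
    using is_prox_exists[OF X(1) X_ne weakly_convex_continuous_on[OF wcf] A5(1) t(1)] by blast
  then obtain p where p: "\<And>y. is_prox t f X y (p y)" by metis
  have near: "norm (p y - y) \<le> 4 * t * L" if "y \<in> X" for y
    using that unfolding f_def
    by (intro is_prox_dist_le[OF p[unfolded f_def] that _ t \<rho> L] agent_mean_lower_bound A5)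
  have \<phi>t_diff: "\<bar>\<phi>t z - \<phi>t y\<bar> \<le> 4 * L * norm (z - y) + 1 / (2 * t) * (norm (z - y))\<^sup>2"
    if "y \<in> X" "z \<in> X" for y z
    unfolding \<phi>t_eq using that by (intro moreau_envelope_diff_le[OF p near p near t(1)])
  have grad: "gradient \<phi>t y = (1 / t) *\<^sub>R (y - p y)" for y
    unfolding \<phi>t_eq by (rule gradient_moreau_envelope[OF p wcf X(2) t(1) t'])
  define G where "G k = (norm (gradient \<phi>t (xbar k)))\<^sup>2" for k
  have G0: "0 \<le> G k" for k by (simp add: G_def)
  have G_eq: "(norm (p (xbar k) - xbar k))\<^sup>2 = t\<^sup>2 * G k" for k
    using t(1) by (simp add: G_def grad power_divide norm_minus_commute)

  obtain m where m: "\<And>y. m \<le> f y" using A5(1) by (auto simp: bdd_below_def)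
  have \<phi>t_ge: "m \<le> \<phi>t y" for y
    unfolding \<phi>t_eq moreau_envelope_prox[OF p] using m[of "p y"] t(1) by (simp add: add_increasing2)
  have INF_le: "(INF y. \<phi>t y) \<le> \<phi>t y" for y
    by (rule cINF_lower) (auto intro: bdd_belowI[of _ m] \<phi>t_ge)

  obtain a where a: "\<And>k. \<alpha> k \<le> a"
  proof -
    have "Bseq \<alpha>" using A6(3) by (intro convergent_imp_Bseq convergentI)
    then obtain K where "\<forall>n. norm (\<alpha> n) \<le> K" unfolding Bseq_def by blast
    then show ?thesis using that[of K] by (simp add: abs_le_iff)
  qed
  \<comment> \<open>the consensus error in the descent inequality, with the disagreement bounded by \<open>M \<alpha>\<close>\<close>
  define C where "C = 1 / (2 * t) * (M\<^sup>2 + 2 * (L * M + \<rho> * (M\<^sup>2 * a)))"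
  have "0 \<le> a" using a[of 0] A6(1)[of 0] by linarith
  then have C0: "0 \<le> C" using t(1) M0 L \<rho> by (simp add: C_def)
  have consensus_error: "1 / (2 * t) * ((D k)\<^sup>2 + 2 * \<alpha> k * (L * D k + \<rho> * (D k)\<^sup>2)) \<le> C * (\<alpha> k)\<^sup>2" for k
  proof -
    have D2: "(D k)\<^sup>2 \<le> (M * \<alpha> k)\<^sup>2" using M D0 by (rule power_mono)
    have "(D k)\<^sup>2 + 2 * \<alpha> k * (L * D k + \<rho> * (D k)\<^sup>2)
        \<le> (M * \<alpha> k)\<^sup>2 + 2 * \<alpha> k * (L * (M * \<alpha> k) + \<rho> * (M * \<alpha> k)\<^sup>2)"
      using D2 M[of k] L \<rho> A6(1)[of k] by (intro add_mono mult_left_mono) auto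
    also have "\<dots> = (M\<^sup>2 + 2 * (L * M + \<rho> * (M\<^sup>2 * \<alpha> k))) * (\<alpha> k)\<^sup>2"
      by (simp add: algebra_simps power2_eq_square)
    also have "\<dots> \<le> (M\<^sup>2 + 2 * (L * M + \<rho> * (M\<^sup>2 * a))) * (\<alpha> k)\<^sup>2"
      using a[of k] \<rho> by (intro mult_right_mono add_left_mono mult_left_mono) auto
    finally have "1 / (2 * t) * ((D k)\<^sup>2 + 2 * \<alpha> k * (L * D k + \<rho> * (D k)\<^sup>2)) \<le> 1 / (2 * t) * \<dots>"
      using t(1) by (intro mult_left_mono) auto
    then show ?thesis by (simp only: C_def mult.assoc)
  qed
  have descent: "\<phi>t (xbar (Suc k)) \<le> \<phi>t (xbar k) - c * (\<alpha> k * G k) + (C * (\<alpha> k)\<^sup>2 + L\<^sup>2 * (\<alpha> k)\<^sup>2 / (2 * t))" for k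
  proof -
    have "\<phi>t (xbar (Suc k)) \<le> \<phi>t (xbar k)
        - \<alpha> k / t * (1 / t - \<rho>) * (norm (p (xbar k) - xbar k))\<^sup>2
        + 1 / (2 * t) * ((D k)\<^sup>2 + 2 * \<alpha> k * (L * D k + \<rho> * (D k)\<^sup>2)) + L\<^sup>2 * (\<alpha> k)\<^sup>2 / (2 * t)"
      unfolding \<phi>t_eq f_def xbar_def D_def
      by (rule moreau_envelope_descent[where P = "A k" and v = "\<lambda>i. v i k" and g = "\<lambda>i. g i k",
            OF X A2 A5(2,3) L xX v g x_Suc t(1) less_imp_le[OF A6(1)]
              p[unfolded f_def] p[unfolded f_def]])
    moreover have "\<alpha> k / t * (1 / t - \<rho>) * (norm (p (xbar k) - xbar k))\<^sup>2 = (1 - t * \<rho>) * (\<alpha> k * G k)"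
      unfolding G_eq using t(1) by (simp add: field_simps power2_eq_square)
    moreover have "c * (\<alpha> k * G k) \<le> (1 - t * \<rho>) * (\<alpha> k * G k)"
      using t(1) \<rho> A6(1)[of k] G0[of k] by (intro mult_right_mono) (auto simp: c_def)
    ultimately show ?thesis using consensus_error[of k] by linarith
  qed

  have part1: "\<exists>\<phi>bar. (\<forall>i. (\<lambda>k. \<phi>t (x i k)) \<longlonglongrightarrow> \<phi>bar) \<and> (\<lambda>k. \<phi>t (xbar k)) \<longlonglongrightarrow> \<phi>bar"
    if "summable (\<lambda>k. (\<alpha> k)\<^sup>2)"
  proof -
    let ?e = "\<lambda>k. C * (\<alpha> k)\<^sup>2 + L\<^sup>2 * (\<alpha> k)\<^sup>2 / (2 * t)"
    have "\<phi>t (xbar (Suc k)) \<le> \<phi>t (xbar k) + ?e k" for k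
    proof -
      have "0 \<le> c * (\<alpha> k * G k)" using c G0[of k] A6(1)[of k] by simp
      then show ?thesis using descent[of k] by linarith
    qed
    moreover have "summable ?e"
      using that by (intro summable_add summable_mult summable_divide)
    moreover have "0 \<le> ?e k" for k using C0 t(1) by simp
    ultimately obtain l where l: "(\<lambda>k. \<phi>t (xbar k)) \<longlonglongrightarrow> l"
      using almost_decreasing_convergent[of "\<lambda>k. \<phi>t (xbar k)" ?e m] \<phi>t_ge by blast
    have "(\<lambda>k. \<phi>t (x i k)) \<longlonglongrightarrow> l" for i
    proof -
      let ?E = "\<lambda>k. 4 * L * norm (x i k - xbar k) + 1 / (2 * t) * (norm (x i k - xbar k))\<^sup>2"
      have "(\<lambda>k. M * \<alpha> k) \<longlonglongrightarrow> M * 0" by (intro tendsto_intros A6(3))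
      then have "(\<lambda>k. norm (x i k - xbar k)) \<longlonglongrightarrow> 0"
        using order_trans[OF dist_mean M]
        by (intro tendsto_sandwich[OF _ _ tendsto_const, of 0 "\<lambda>k. norm (x i k - xbar k)" _ "\<lambda>k. M * \<alpha> k"]) auto
      then have "?E \<longlonglongrightarrow> 4 * L * 0 + 1 / (2 * t) * 0\<^sup>2"
        by (intro tendsto_intros)
      then have "?E \<longlonglongrightarrow> 0" by simp
      moreover have "\<forall>\<^sub>F k in sequentially. norm (\<phi>t (x i k) - \<phi>t (xbar k)) \<le> ?E k"
        unfolding real_norm_def by (intro always_eventually allI \<phi>t_diff xbarX xX)
      ultimately have "(\<lambda>k. \<phi>t (x i k) - \<phi>t (xbar k)) \<longlonglongrightarrow> 0"
        by (rule Lim_null_comparison[rotated])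
      from tendsto_add[OF this l] show ?thesis by simp
    qed
    with l show ?thesis by blast
  qed

  have part2: "\<exists>b. b \<in> O(\<lambda>k. L\<^sup>2 * (\<alpha> k)\<^sup>2 / (1 - lam)\<^sup>2) \<and> (\<forall>k. 0 \<le> b k) \<and>
      (\<forall>K. (INF k\<in>{..K}. G k) \<le> 1 / c *
        ((\<phi>t (xbar 0) - (INF y. \<phi>t y) + (\<Sum>k\<le>K. b k) + (\<Sum>k\<le>K. L\<^sup>2 * (\<alpha> k)\<^sup>2 / (2 * t)))
          / (\<Sum>k\<le>K. \<alpha> k)))"
    if lam: "lam < 1" for lam
  proof (cases "L = 0")
    case True
    \<comment> \<open>for \<open>L = 0\<close> every point of \<open>X\<close> is its own proximal point\<close>
    have "p (xbar k) = xbar k" for k using near[OF xbarX[of k]] True by simp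
    then have "G k = 0" for k by (simp add: G_def grad)
    moreover have "0 \<le> 1 / c * ((\<phi>t (xbar 0) - (INF y. \<phi>t y)) / (\<Sum>k\<le>K. \<alpha> k))" for K
      using c INF_le[of "xbar 0"] A6(1) by (simp add: sum_nonneg less_imp_le)
    ultimately show ?thesis using True by (intro exI[of _ "\<lambda>_. 0"]) simp
  next
    case False
    have "(\<lambda>k. C * (\<alpha> k)\<^sup>2) \<in> O(\<lambda>k. L\<^sup>2 * (\<alpha> k)\<^sup>2 / (1 - lam)\<^sup>2)"
    proof (rule bigoI[where c = "C * (1 - lam)\<^sup>2 / L\<^sup>2"], rule always_eventually, rule allI)
      fix k
      show "norm (C * (\<alpha> k)\<^sup>2) \<le> C * (1 - lam)\<^sup>2 / L\<^sup>2 * norm (L\<^sup>2 * (\<alpha> k)\<^sup>2 / (1 - lam)\<^sup>2)"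
        using False lam C0 by (simp add: abs_mult)
    qed
    moreover have "(INF k\<in>{..K}. G k) \<le> 1 / c *
        ((\<phi>t (xbar 0) - (INF y. \<phi>t y) + (\<Sum>k\<le>K. C * (\<alpha> k)\<^sup>2) + (\<Sum>k\<le>K. L\<^sup>2 * (\<alpha> k)\<^sup>2 / (2 * t)))
          / (\<Sum>k\<le>K. \<alpha> k))" for K
      using descent_INF_le[of "\<lambda>k. \<phi>t (xbar k)", OF descent INF_le c G0 A6(1), of K]
      by (simp add: sum.distrib add.assoc)
    ultimately show ?thesis using C0 by (intro exI[of _ "\<lambda>k. C * (\<alpha> k)\<^sup>2"]) auto
  qed

  have "(INF k. G k) \<le> 0"
  proof (rule descent_INF_eq_0[of "\<lambda>k. \<phi>t (xbar k)" c \<alpha> G "C + L\<^sup>2 / (2 * t)" m])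
    show "\<phi>t (xbar (Suc k)) \<le> \<phi>t (xbar k) - c * (\<alpha> k * G k) + (C + L\<^sup>2 / (2 * t)) * (\<alpha> k)\<^sup>2" for k
      using descent[of k] by (simp add: algebra_simps)
  qed (use \<phi>t_ge c G0 A6 in auto)
  \<comment> \<open>the denominator is infinite, so the right-hand side is 0\<close>
  then have infinite: "ereal (INF k. G k) \<le> ereal (1 / c) * (R / (\<Sum>k. ereal (\<alpha> k)))" for R
    by (simp add: suminf_ereal_diverges[OF A6(2)])
  have c_eq: "2 / (1 - 2 * t * \<rho>) = 1 / c" by (simp add: c_def)
  show ?thesis
    unfolding c_eq G_def[symmetric]
  proof (intro conjI impI allI)
    fix rate lam assume "consensus_rate A rate lam"
    then have "lam < 1" by (simp add: consensus_rate_def)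
    from part2[OF this] obtain b where "b \<in> O(\<lambda>k. L\<^sup>2 * (\<alpha> k)\<^sup>2 / (1 - lam)\<^sup>2)" "\<forall>k. 0 \<le> b k"
      "\<forall>K. (INF k\<in>{..K}. G k) \<le> 1 / c *
        ((\<phi>t (xbar 0) - (INF y. \<phi>t y) + (\<Sum>k\<le>K. b k) + (\<Sum>k\<le>K. L\<^sup>2 * (\<alpha> k)\<^sup>2 / (2 * t)))
          / (\<Sum>k\<le>K. \<alpha> k))"
      by (elim exE conjE)
    then show "\<exists>b. b \<in> O(\<lambda>k. L\<^sup>2 * (\<alpha> k)\<^sup>2 / (1 - lam)\<^sup>2) \<and> (\<forall>k. 0 \<le> b k) \<and>
      (\<forall>K. (INF k\<in>{..K}. G k) \<le> 1 / c *
        ((\<phi>t (xbar 0) - (INF y. \<phi>t y) + (\<Sum>k\<le>K. b k) + (\<Sum>k\<le>K. L\<^sup>2 * (\<alpha> k)\<^sup>2 / (2 * t)))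
          / (\<Sum>k\<le>K. \<alpha> k))) \<and>
      ereal (INF k. G k) \<le> ereal (1 / c) *
        ((ereal (\<phi>t (xbar 0) - (INF y. \<phi>t y)) + (\<Sum>k. ereal (b k))
            + (\<Sum>k. ereal (L\<^sup>2 * (\<alpha> k)\<^sup>2 / (2 * t)))) / (\<Sum>k. ereal (\<alpha> k)))"
      by (intro exI[of _ b] conjI infinite)
  qed (rule part1)
qed

end
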